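(* Let $\mathcal{C}$ be a type-theoretic fibration category, and let $\mathcal{W}$ be the class of homotopy equivalences in $\mathcal{C}$. Then $\mathcal{C}$, with its fibrations and with $\mathcal{W}$ as the weak equivalences, is a category of fibrant objects.
   Context: A type-theoretic fibration category is a category $\mathcal{C}$ with the following structure. (1) A terminal object $1$. (2) A subcategory $\mathcal{F}\subset\mathcal{C}$ containing all objects, all isomorphisms, and all morphisms with codomain $1$; morphisms of $\mathcal{F}$ are called fibrations, and a morphism is called an acyclic cofibration if it has the left lifting property with respect to all fibrations. (3) All pullbacks of fibrations (along arbitrary morphisms) exist and are fibrations. (4) For every fibration $g:A\to B$, the pullback functor $g^*:\mathcal{C}/B\to\mathcal{C}/A$ has a partial right adjoint $\Pi_g$, defined at all fibrations over $A$, whose values are fibrations over $B$. (5) Every morphism factors as an acyclic cofibration followed by a fibration. (6) If $A\to C$ and $B\to C$ are fibrations, $A\to B$ is an acyclic cofibration over $C$, and $Z\to C$ is any morphism, then the induced map $Z\times_C A\to Z\times_C B$ is an acyclic cofibration. A path object for $B$ is a factorization $B\to PB\to B\times B$ of the diagonal as an acyclic cofibration followed by a fibration. A homotopy $f\sim g$ between $f,g:A\rightrightarrows B$ is a lift of $(f,g):A\to B\times B$ to a path object $PB$ (existence does not depend on the choice of path object). A morphism $f:A\to B$ is a homotopy equivalence if there is $g:B\to A$ with $gf\sim 1_A$ and $fg\sim 1_B$. A category of fibrant objects (in the sense of Brown) is a category with a terminal object and a subcategory of fibrations satisfying (1)--(3) above, equipped with a further subcategory $\mathcal{W}$ of weak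 equivalences such that: $\mathcal{W}$ contains all isomorphisms; if two of $f$, $g$, $gf$ are in $\mathcal{W}$ then so is the third; any diagonal $B\to B\times B$ factors as a map in $\mathcal{W}$ followed by a fibration; and any pullback of a fibration that lies in $\mathcal{W}$ also lies in $\mathcal{W}$. *)

theory Defs
  imports Main
begin

section \<open>Categories\<close>

record ('o, 'a) cat =
  Obj :: "'o set"
  Arr :: "'a set"
  Dom :: "'a \<Rightarrow> 'o"
  Cod :: "'a \<Rightarrow> 'o"
  Idn :: "'o \<Rightarrow> 'a"
  Cmp :: "'a \<Rightarrow> 'a \<Rightarrow> 'a"  (infixr "\<cdot>\<index>" 70)

definition Hom :: "('o, 'a) cat \<Rightarrow> 'o \<Rightarrow> 'o \<Rightarrow> 'a set" where
  "Hom C A B = {f \<in> Arr C. Dom C f = A \<and> Cod C f = B}"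

locale category =
  fixes C :: "('o, 'a) cat" (structure)
  assumes Dom_in_Obj: "f \<in> Arr C \<Longrightarrow> Dom C f \<in> Obj C"
    and Cod_in_Obj: "f \<in> Arr C \<Longrightarrow> Cod C f \<in> Obj C"
    and Idn_in_Hom: "A \<in> Obj C \<Longrightarrow> Idn C A \<in> Hom C A A"
    and Cmp_in_Hom: "f \<in> Hom C A B \<Longrightarrow> g \<in> Hom C B D \<Longrightarrow> g \<cdot> f \<in> Hom C A D"
    and Idn_left: "f \<in> Hom C A B \<Longrightarrow> Idn C B \<cdot> f = f"
    and Idn_right: "f \<in> Hom C A B \<Longrightarrow> f \<cdot> Idn C A = f"
    and Cmp_assoc: "f \<in> Hom C A B \<Longrightarrow> g \<in> Hom C B D \<Longrightarrow> h \<in> Hom C D E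
      \<Longrightarrow> (h \<cdot> g) \<cdot> f = h \<cdot> (g \<cdot> f)"

definition is_iso :: "('o, 'a) cat \<Rightarrow> 'a \<Rightarrow> bool" where
  "is_iso C f \<longleftrightarrow> f \<in> Arr C \<and> (\<exists>g \<in> Hom C (Cod C f) (Dom C f).
     g \<cdot>\<^bsub>C\<^esub> f = Idn C (Dom C f) \<and> f \<cdot>\<^bsub>C\<^esub> g = Idn C (Cod C f))"

definition is_terminal :: "('o, 'a) cat \<Rightarrow> 'o \<Rightarrow> bool" where
  "is_terminal C T \<longleftrightarrow> T \<in> Obj C \<and> (\<forall>A \<in> Obj C. \<exists>!f. f \<in> Hom C A T)"

text \<open>A subcategory with the same objects, given by its set of arrows.\<close>

definition wide_subcategory :: "('o, 'a) cat \<Rightarrow> 'a set \<Rightarrow> bool" where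
  "wide_subcategory C S \<longleftrightarrow> S \<subseteq> Arr C \<and> (\<forall>A \<in> Obj C. Idn C A \<in> S) \<and>
     (\<forall>f \<in> S. \<forall>g \<in> S. Cod C f = Dom C g \<longrightarrow> g \<cdot>\<^bsub>C\<^esub> f \<in> S)"

definition full_subcategory :: "('o, 'a) cat \<Rightarrow> 'o set \<Rightarrow> ('o, 'a) cat" where
  "full_subcategory C S =
     C\<lparr>Obj := S, Arr := {f \<in> Arr C. Dom C f \<in> S \<and> Cod C f \<in> S}\<rparr>"

text \<open>
  The square with \<open>p : P \<rightarrow> X\<close>, \<open>q : P \<rightarrow> Y\<close>, \<open>f : X \<rightarrow> Z\<close>, \<open>g : Y \<rightarrow> Z\<close> is a pullback;
  so \<open>p\<close> is the pullback of \<open>g\<close> along \<open>f\<close>, and \<open>q\<close> is the pullback of \<open>f\<close> along \<open>g\<close>.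
\<close>

definition is_pullback :: "('o, 'a) cat \<Rightarrow> 'a \<Rightarrow> 'a \<Rightarrow> 'a \<Rightarrow> 'a \<Rightarrow> bool" where
  "is_pullback C f g p q \<longleftrightarrow>
     f \<in> Arr C \<and> g \<in> Arr C \<and> Cod C f = Cod C g \<and>
     Dom C p = Dom C q \<and>
     p \<in> Hom C (Dom C p) (Dom C f) \<and> q \<in> Hom C (Dom C p) (Dom C g) \<and>
     f \<cdot>\<^bsub>C\<^esub> p = g \<cdot>\<^bsub>C\<^esub> q \<and>
     (\<forall>T \<in> Obj C. \<forall>u \<in> Hom C T (Dom C f). \<forall>v \<in> Hom C T (Dom C g).
        f \<cdot>\<^bsub>C\<^esub> u = g \<cdot>\<^bsub>C\<^esub> v \<longrightarrow>
        (\<exists>!w. w \<in> Hom C T (Dom C p) \<and> p \<cdot>\<^bsub>C\<^esub> w = u \<and> q \<cdot>\<^bsub>C\<^esub> w = v))"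

definition is_product :: "('o, 'a) cat \<Rightarrow> 'o \<Rightarrow> 'o \<Rightarrow> 'o \<Rightarrow> 'a \<Rightarrow> 'a \<Rightarrow> bool" where
  "is_product C A B Q p q \<longleftrightarrow>
     A \<in> Obj C \<and> B \<in> Obj C \<and> Q \<in> Obj C \<and> p \<in> Hom C Q A \<and> q \<in> Hom C Q B \<and>
     (\<forall>T \<in> Obj C. \<forall>u \<in> Hom C T A. \<forall>v \<in> Hom C T B.
        \<exists>!w. w \<in> Hom C T Q \<and> p \<cdot>\<^bsub>C\<^esub> w = u \<and> q \<cdot>\<^bsub>C\<^esub> w = v)"

text \<open>The map \<open>(u, v)\<close> into the product whose projections are \<open>p\<close> and \<open>q\<close>.\<close>

definition pairing :: "('o, 'a) cat \<Rightarrow> 'a \<Rightarrow> 'a \<Rightarrow> 'a \<Rightarrow> 'a \<Rightarrow> 'a" where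
  "pairing C p q u v =
     (THE w. w \<in> Hom C (Dom C u) (Dom C p) \<and> p \<cdot>\<^bsub>C\<^esub> w = u \<and> q \<cdot>\<^bsub>C\<^esub> w = v)"

definition diagonal :: "('o, 'a) cat \<Rightarrow> 'o \<Rightarrow> 'a \<Rightarrow> 'a \<Rightarrow> 'a" where
  "diagonal C B p q = pairing C p q (Idn C B) (Idn C B)"


section \<open>Functors, slices and partial right adjoints\<close>

record ('o, 'a, 'o2, 'a2) func =
  fobj :: "'o \<Rightarrow> 'o2"
  farr :: "'a \<Rightarrow> 'a2"

definition is_functor ::
    "('o, 'a) cat \<Rightarrow> ('o2, 'a2) cat \<Rightarrow> ('o, 'a, 'o2, 'a2) func \<Rightarrow> bool" where
  "is_functor C D F \<longleftrightarrow>
     (\<forall>A \<in> Obj C. fobj F A \<in> Obj D) \<and>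
     (\<forall>f \<in> Arr C. farr F f \<in> Hom D (fobj F (Dom C f)) (fobj F (Cod C f))) \<and>
     (\<forall>A \<in> Obj C. farr F (Idn C A) = Idn D (fobj F A)) \<and>
     (\<forall>f \<in> Arr C. \<forall>g \<in> Arr C. Cod C f = Dom C g \<longrightarrow>
        farr F (g \<cdot>\<^bsub>C\<^esub> f) = farr F g \<cdot>\<^bsub>D\<^esub> farr F f)"

text \<open>
  \<open>R\<close>, defined on the full subcategory of \<open>D\<close> on the objects \<open>S\<close>, is a partial right adjoint
  of \<open>L : C \<rightarrow> D\<close>: there are bijections \<open>\<phi> : D(L c, d) \<cong> C(c, R d)\<close> for \<open>c\<close> in \<open>C\<close> and \<open>d\<close> in \<open>S\<close>,
  natural in \<open>c\<close> and \<open>d\<close>.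
\<close>

definition partial_right_adjoint ::
    "('o, 'a) cat \<Rightarrow> ('o2, 'a2) cat \<Rightarrow> ('o, 'a, 'o2, 'a2) func \<Rightarrow> 'o2 set \<Rightarrow>
     ('o2, 'a2, 'o, 'a) func \<Rightarrow> bool" where
  "partial_right_adjoint C D L S R \<longleftrightarrow>
     S \<subseteq> Obj D \<and> is_functor (full_subcategory D S) C R \<and>
     (\<exists>\<phi>. (\<forall>c \<in> Obj C. \<forall>d \<in> S.
             bij_betw (\<phi> c d) (Hom D (fobj L c) d) (Hom C c (fobj R d))) \<and>
          (\<forall>k \<in> Arr C. \<forall>d \<in> S. \<forall>h \<in> Hom D (fobj L (Cod C k)) d.
             \<phi> (Dom C k) d (h \<cdot>\<^bsub>D\<^esub> farr L k) = \<phi> (Cod C k) d h \<cdot>\<^bsub>C\<^esub> k) \<and>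
          (\<forall>c \<in> Obj C. \<forall>d \<in> S. \<forall>d' \<in> S. \<forall>m \<in> Hom D d d'. \<forall>h \<in> Hom D (fobj L c) d.
             \<phi> c d' (m \<cdot>\<^bsub>D\<^esub> h) = farr R m \<cdot>\<^bsub>C\<^esub> \<phi> c d h))"

text \<open>
  The slice category \<open>C/B\<close>.  An arrow from \<open>x\<close> to \<open>y\<close> is a triple \<open>(x, h, y)\<close> with
  \<open>y \<cdot> h = x\<close>; source and target have to be recorded because \<open>h\<close> alone does not determine
  \<open>y\<close>.
\<close>

definition slice :: "('o, 'a) cat \<Rightarrow> 'o \<Rightarrow> ('a, 'a \<times> 'a \<times> 'a) cat" where
  "slice C B = \<lparr>
     Obj = {x \<in> Arr C. Cod C x = B},
     Arr = {(x, h, y). x \<in> Arr C \<and> Cod C x = B \<and> y \<in> Arr C \<and> Cod C y = B \<and>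
              h \<in> Hom C (Dom C x) (Dom C y) \<and> y \<cdot>\<^bsub>C\<^esub> h = x},
     Dom = (\<lambda>(x, h, y). x),
     Cod = (\<lambda>(x, h, y). y),
     Idn = (\<lambda>x. (x, Idn C (Dom C x), x)),
     Cmp = (\<lambda>(y', k, z) (x, h, y). (x, k \<cdot>\<^bsub>C\<^esub> h, z))\<rparr>"

text \<open>
  The pullback functor \<open>g\<^sup>* : C/B \<rightarrow> C/A\<close> of \<open>g : A \<rightarrow> B\<close>, meaningful if \<open>g\<close> has pullbacks along
  all maps into \<open>B\<close>.  It is formed from arbitrarily chosen pullbacks; another choice gives a
  naturally isomorphic one.
\<close>

definition chosen_pullback :: "('o, 'a) cat \<Rightarrow> 'a \<Rightarrow> 'a \<Rightarrow> 'a \<times> 'a" where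
  "chosen_pullback C g y = (SOME (p, q). is_pullback C g y p q)"

definition pullback_functor ::
    "('o, 'a) cat \<Rightarrow> 'a \<Rightarrow> ('a, 'a \<times> 'a \<times> 'a, 'a, 'a \<times> 'a \<times> 'a) func" where
  "pullback_functor C g = \<lparr>
     fobj = (\<lambda>y. fst (chosen_pullback C g y)),
     farr = (\<lambda>(y, h, y').
       let (p, q) = chosen_pullback C g y; (p', q') = chosen_pullback C g y'
       in (p, (THE w. w \<in> Hom C (Dom C p) (Dom C p') \<and>
                 p' \<cdot>\<^bsub>C\<^esub> w = p \<and> q' \<cdot>\<^bsub>C\<^esub> w = h \<cdot>\<^bsub>C\<^esub> q), p'))\<rparr>"


section \<open>Type-theoretic fibration categories\<close>

text \<open>
  The axioms shared by type-theoretic fibration categories and categories of fibrant objects.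
\<close>

locale category_with_fibrations = category C
  for C :: "('o, 'a) cat" (structure) +
  fixes one :: 'o and Fib :: "'a set"
  assumes one_terminal: "is_terminal C one"
    and Fib_subcategory: "wide_subcategory C Fib"
    and Fib_iso: "is_iso C f \<Longrightarrow> f \<in> Fib"
    and Fib_to_one: "f \<in> Arr C \<Longrightarrow> Cod C f = one \<Longrightarrow> f \<in> Fib"
    and Fib_pullback_exists:
      "f \<in> Fib \<Longrightarrow> h \<in> Arr C \<Longrightarrow> Cod C h = Cod C f \<Longrightarrow> \<exists>p q. is_pullback C h f p q"
    and Fib_pullback: "f \<in> Fib \<Longrightarrow> is_pullback C h f p q \<Longrightarrow> p \<in> Fib"

definition left_lifting :: "('o, 'a) cat \<Rightarrow> 'a \<Rightarrow> 'a \<Rightarrow> bool" where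
  "left_lifting C i p \<longleftrightarrow>
     (\<forall>u \<in> Hom C (Dom C i) (Dom C p). \<forall>v \<in> Hom C (Cod C i) (Cod C p).
        p \<cdot>\<^bsub>C\<^esub> u = v \<cdot>\<^bsub>C\<^esub> i \<longrightarrow>
        (\<exists>l \<in> Hom C (Cod C i) (Dom C p). l \<cdot>\<^bsub>C\<^esub> i = u \<and> p \<cdot>\<^bsub>C\<^esub> l = v))"

definition acyclic_cofibration :: "('o, 'a) cat \<Rightarrow> 'a set \<Rightarrow> 'a \<Rightarrow> bool" where
  "acyclic_cofibration C Fib i \<longleftrightarrow> i \<in> Arr C \<and> (\<forall>p \<in> Fib. left_lifting C i p)"

locale type_theoretic_fibration_category = category_with_fibrations C one Fib
  for C :: "('o, 'a) cat" (structure) and one :: 'o and Fib :: "'a set" +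
  assumes dependent_products:
      "g \<in> Fib \<Longrightarrow> g \<in> Hom C A B \<Longrightarrow>
       \<exists>Pi. partial_right_adjoint (slice C B) (slice C A) (pullback_functor C g)
              {x \<in> Fib. Cod C x = A} Pi \<and>
            (\<forall>x \<in> Fib. Cod C x = A \<longrightarrow> fobj Pi x \<in> Fib)"
    and factorization:
      "f \<in> Arr C \<Longrightarrow> \<exists>i p. acyclic_cofibration C Fib i \<and> p \<in> Fib \<and>
         Cod C i = Dom C p \<and> p \<cdot> i = f"
    and acyclic_cofibration_pullback:
      "a \<in> Fib \<Longrightarrow> b \<in> Fib \<Longrightarrow> acyclic_cofibration C Fib i \<Longrightarrow>
       i \<in> Hom C (Dom C a) (Dom C b) \<Longrightarrow> Cod C a = Cod C b \<Longrightarrow> b \<cdot> i = a \<Longrightarrow>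
       is_pullback C z a p q \<Longrightarrow> is_pullback C z b p' q' \<Longrightarrow>
       u \<in> Hom C (Dom C p) (Dom C p') \<Longrightarrow> p' \<cdot> u = p \<Longrightarrow> q' \<cdot> u = i \<cdot> q \<Longrightarrow>
       acyclic_cofibration C Fib u"


section \<open>Homotopy equivalences\<close>

text \<open>
  \<open>B \<rightarrow> PB \<rightarrow> Q\<close> is the factorization \<open>e \<cdot> r\<close>, where \<open>Q\<close> is a product of \<open>B\<close> with itself with
  projections \<open>\<pi>\<^sub>1\<close> and \<open>\<pi>\<^sub>2\<close>, and the path object itself is the domain of \<open>e\<close>.
\<close>

definition path_object ::
    "('o, 'a) cat \<Rightarrow> 'a set \<Rightarrow> 'o \<Rightarrow> 'o \<Rightarrow> 'a \<Rightarrow> 'a \<Rightarrow> 'a \<Rightarrow> 'a \<Rightarrow> bool" where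
  "path_object C Fib B Q \<pi>\<^sub>1 \<pi>\<^sub>2 r e \<longleftrightarrow>
     is_product C B B Q \<pi>\<^sub>1 \<pi>\<^sub>2 \<and>
     acyclic_cofibration C Fib r \<and> e \<in> Fib \<and>
     r \<in> Hom C B (Dom C e) \<and> e \<in> Hom C (Dom C e) Q \<and>
     e \<cdot>\<^bsub>C\<^esub> r = diagonal C B \<pi>\<^sub>1 \<pi>\<^sub>2"

definition homotopic :: "('o, 'a) cat \<Rightarrow> 'a set \<Rightarrow> 'a \<Rightarrow> 'a \<Rightarrow> bool" where
  "homotopic C Fib f g \<longleftrightarrow>
     f \<in> Arr C \<and> g \<in> Arr C \<and> Dom C f = Dom C g \<and> Cod C f = Cod C g \<and>
     (\<exists>Q \<pi>\<^sub>1 \<pi>\<^sub>2 r e. path_object C Fib (Cod C f) Q \<pi>\<^sub>1 \<pi>\<^sub>2 r e \<and>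
        (\<exists>h \<in> Hom C (Dom C f) (Dom C e). e \<cdot>\<^bsub>C\<^esub> h = pairing C \<pi>\<^sub>1 \<pi>\<^sub>2 f g))"

definition homotopy_equivalence :: "('o, 'a) cat \<Rightarrow> 'a set \<Rightarrow> 'a \<Rightarrow> bool" where
  "homotopy_equivalence C Fib f \<longleftrightarrow>
     f \<in> Arr C \<and> (\<exists>g \<in> Hom C (Cod C f) (Dom C f).
        homotopic C Fib (g \<cdot>\<^bsub>C\<^esub> f) (Idn C (Dom C f)) \<and>
        homotopic C Fib (f \<cdot>\<^bsub>C\<^esub> g) (Idn C (Cod C f)))"


section \<open>Categories of fibrant objects\<close>

text \<open>
  The product \<open>Q = B \<times> B\<close> in \<open>diagonal_factorization\<close> always exists, as a pullback of the
  fibration \<open>B \<rightarrow> one\<close> along itself.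
\<close>

locale category_of_fibrant_objects = category_with_fibrations C one Fib
  for C :: "('o, 'a) cat" (structure) and one :: 'o and Fib :: "'a set" +
  fixes W :: "'a set"
  assumes W_subcategory: "wide_subcategory C W"
    and W_iso: "is_iso C f \<Longrightarrow> f \<in> W"
    and W_comp: "f \<in> Hom C X Y \<Longrightarrow> g \<in> Hom C Y Z \<Longrightarrow> f \<in> W \<Longrightarrow> g \<in> W \<Longrightarrow> g \<cdot> f \<in> W"
    and W_cancel_left:
      "f \<in> Hom C X Y \<Longrightarrow> g \<in> Hom C Y Z \<Longrightarrow> g \<in> W \<Longrightarrow> g \<cdot> f \<in> W \<Longrightarrow> f \<in> W"
    and W_cancel_right:
      "f \<in> Hom C X Y \<Longrightarrow> g \<in> Hom C Y Z \<Longrightarrow> f \<in> W \<Longrightarrow> g \<cdot> f \<in> W \<Longrightarrow> g \<in> W"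
    and diagonal_factorization:
      "is_product C B B Q \<pi>\<^sub>1 \<pi>\<^sub>2 \<Longrightarrow>
       \<exists>w p. w \<in> W \<and> p \<in> Fib \<and> Cod C w = Dom C p \<and> p \<cdot> w = diagonal C B \<pi>\<^sub>1 \<pi>\<^sub>2"
    and acyclic_fibration_pullback:
      "f \<in> Fib \<Longrightarrow> f \<in> W \<Longrightarrow> is_pullback C h f p q \<Longrightarrow> p \<in> W"

end

theory Submission
  imports Defs
begin

text \<open>
  Two maps are homotopic as soon as they are \<open>S \<cdot> h\<close> and \<open>T \<cdot> h\<close> for maps \<open>S, T\<close> equalized by an
  acyclic cofibration. In this form, homotopy is visibly stable under composition on both sides;
  transitivity comes from the acyclic cofibration \<open>P \<rightarrow> P \<times>\<^sub>A P\<close> obtained by pulling back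
  \<open>A \<rightarrow> P\<close>. So homotopy equivalences are the maps that become invertible in a quotient category,
  which gives two-out-of-three, and acyclic cofibrations are among them.

  For an acyclic fibration \<open>f : A \<rightarrow> B\<close>, path lifting turns a homotopy inverse into a strict
  section \<open>s\<close>, and a homotopy \<open>s f \<sim> 1\<close> can be rectified to one over \<open>B\<close>. A pullback of
  a fibrewise path object of \<open>A\<close> then carries the homotopy that makes the pulled-back section
  a homotopy inverse.
\<close>

section \<open>Pullbacks and products in an arbitrary category\<close>

context category
begin

lemma Hom_Obj: "f \<in> Hom C A B \<Longrightarrow> A \<in> Obj C" "f \<in> Hom C A B \<Longrightarrow> B \<in> Obj C"
  using Dom_in_Obj Cod_in_Obj by (auto simp: Hom_def)

lemma Hom_DomCod: "f \<in> Hom C A B \<Longrightarrow> Dom C f = A" "f \<in> Hom C A B \<Longrightarrow> Cod C f = B"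
  "f \<in> Hom C A B \<Longrightarrow> f \<in> Arr C"
  by (auto simp: Hom_def)

lemma Cmp_reassoc:
  "f \<in> Hom C A B \<Longrightarrow> g \<in> Hom C B D \<Longrightarrow> h \<in> Hom C D E \<Longrightarrow> h \<cdot> g = k \<Longrightarrow> h \<cdot> (g \<cdot> f) = k \<cdot> f"
  using Cmp_assoc[of f A B g D h E] by simp

lemma pullback_square:
  assumes "is_pullback C f g p q" "f \<in> Hom C X Z" "g \<in> Hom C Y Z"
  shows "p \<in> Hom C (Dom C p) X" "q \<in> Hom C (Dom C p) Y" "f \<cdot> p = g \<cdot> q"
  using assms(1)
  unfolding is_pullback_def Hom_DomCod[OF assms(2)] Hom_DomCod[OF assms(3)] by blast+

lemma pullback_universal:
  assumes "is_pullback C f g p q" "f \<in> Hom C X Z" "g \<in> Hom C Y Z"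
    and "u \<in> Hom C T X" "v \<in> Hom C T Y" "f \<cdot> u = g \<cdot> v"
  shows "\<exists>!w. w \<in> Hom C T (Dom C p) \<and> p \<cdot> w = u \<and> q \<cdot> w = v"
  using assms(1,4-6) Hom_Obj(1)[OF assms(4)]
  unfolding is_pullback_def Hom_DomCod[OF assms(2)] Hom_DomCod[OF assms(3)] by metis

lemma pullback_lift:
  assumes "is_pullback C f g p q" "f \<in> Hom C X Z" "g \<in> Hom C Y Z"
    and "u \<in> Hom C T X" "v \<in> Hom C T Y" "f \<cdot> u = g \<cdot> v"
  obtains w where "w \<in> Hom C T (Dom C p)" "p \<cdot> w = u" "q \<cdot> w = v"
  using pullback_universal[OF assms] that by blast

lemma pullback_eqI:
  assumes "is_pullback C f g p q" "f \<in> Hom C X Z" "g \<in> Hom C Y Z"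
    and w: "w \<in> Hom C T (Dom C p)" "w' \<in> Hom C T (Dom C p)" "p \<cdot> w = p \<cdot> w'" "q \<cdot> w = q \<cdot> w'"
  shows "w = w'"
proof -
  note pq = pullback_square[OF assms(1-3)]
  note pw = Cmp_in_Hom[OF w(2) pq(1)] and qw = Cmp_in_Hom[OF w(2) pq(2)]
  have "f \<cdot> (p \<cdot> w') = g \<cdot> (q \<cdot> w')"
    using Cmp_assoc[OF w(2) pq(1) assms(2)] Cmp_assoc[OF w(2) pq(2) assms(3)] pq(3) by simp
  from pullback_universal[OF assms(1-3) pw qw this] show ?thesis using w by blast
qed

text \<open>Serves to compare \<open>Z\<close> itself with other pullbacks along \<open>g\<close>:
  the base change axiom for acyclic cofibrations can then be applied to maps that start at the
  trivial fibration \<open>Idn C A\<close>.\<close>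

lemma pullback_Idn:
  assumes "g \<in> Hom C Z A"
  shows "is_pullback C g (Idn C A) (Idn C Z) g"
proof -
  note o = Hom_Obj[OF assms]
  note i = Idn_in_Hom[OF o(1)] Idn_in_Hom[OF o(2)]
  have univ: "\<exists>!w. w \<in> Hom C T Z \<and> Idn C Z \<cdot> w = u \<and> g \<cdot> w = v"
    if "u \<in> Hom C T Z" "v \<in> Hom C T A" "g \<cdot> u = Idn C A \<cdot> v" for T u v
  proof (rule ex1I[of _ u])
    show "u \<in> Hom C T Z \<and> Idn C Z \<cdot> u = u \<and> g \<cdot> u = v"
      using that Idn_left[OF that(1)] Idn_left[OF that(2)] by simp
    show "w = u" if "w \<in> Hom C T Z \<and> Idn C Z \<cdot> w = u \<and> g \<cdot> w = v" for w
      using that Idn_left[of w T Z] by simp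
  qed
  show ?thesis
    unfolding is_pullback_def Hom_DomCod[OF assms] Hom_DomCod(1,2)[OF i(1)] Hom_DomCod(1,2)[OF i(2)]
    using assms i univ Idn_left[OF assms] Idn_right[OF assms] Hom_DomCod(3)[OF assms]
      Hom_DomCod(3)[OF i(2)] by simp
qed

lemma pairing_product:
  assumes "is_product C A B Q p q" "u \<in> Hom C T A" "v \<in> Hom C T B"
  shows "pairing C p q u v \<in> Hom C T Q" "p \<cdot> pairing C p q u v = u" "q \<cdot> pairing C p q u v = v"
proof -
  have "Dom C u = T" "Dom C p = Q" using assms by (auto simp: is_product_def Hom_def)
  moreover have "\<exists>!w. w \<in> Hom C T Q \<and> p \<cdot> w = u \<and> q \<cdot> w = v"
    using assms Hom_Obj[OF assms(2)] unfolding is_product_def by blast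
  ultimately show "pairing C p q u v \<in> Hom C T Q" "p \<cdot> pairing C p q u v = u" "q \<cdot> pairing C p q u v = v"
    unfolding pairing_def using theI'[of "\<lambda>w. w \<in> Hom C T Q \<and> p \<cdot> w = u \<and> q \<cdot> w = v"] by auto
qed

lemma pairing_eqI:
  assumes "is_product C A B Q p q" "w \<in> Hom C T Q" "p \<cdot> w = u" "q \<cdot> w = v"
  shows "w = pairing C p q u v"
proof -
  have pq: "p \<in> Hom C Q A" "q \<in> Hom C Q B" using assms(1) by (auto simp: is_product_def)
  have uv: "u \<in> Hom C T A" "v \<in> Hom C T B" using assms pq Cmp_in_Hom by blast+
  show ?thesis
    using pairing_product[OF assms(1) uv] assms(2-4) uv Hom_Obj[OF assms(2)] assms(1)
    unfolding is_product_def by blast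
qed

end

section \<open>Consequences of the fibration axioms, and lifting against fibrations\<close>

context category_with_fibrations
begin

lemma obtain_to_one:
  assumes "A \<in> Obj C"
  obtains t where "t \<in> Hom C A one" "t \<in> Fib"
proof -
  obtain t where "t \<in> Hom C A one" using assms one_terminal by (auto simp: is_terminal_def)
  then show thesis using that Fib_to_one by (auto simp: Hom_def)
qed

lemma to_one_unique: "s \<in> Hom C A one \<Longrightarrow> t \<in> Hom C A one \<Longrightarrow> s = t"
  using one_terminal Hom_Obj(1) by (fastforce simp: is_terminal_def)

lemma Fib_Idn: "A \<in> Obj C \<Longrightarrow> Idn C A \<in> Fib"
  using Fib_subcategory by (auto simp: wide_subcategory_def)

lemma Fib_Cmp:
  assumes "f \<in> Hom C A B" "g \<in> Hom C B D" "f \<in> Fib" "g \<in> Fib"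
  shows "g \<cdot> f \<in> Fib"
proof -
  have "Cod C f = Dom C g" using assms by (simp add: Hom_def)
  then show ?thesis using assms(3,4) Fib_subcategory unfolding wide_subcategory_def by blast
qed

lemma obtain_pullback:
  assumes "f \<in> Fib" "f \<in> Hom C A B" "h \<in> Hom C Z B"
  obtains E p q where "is_pullback C h f p q" "p \<in> Hom C E Z" "q \<in> Hom C E A" "p \<in> Fib"
    "h \<cdot> p = f \<cdot> q" "Dom C p = E"
proof -
  obtain p q where pb: "is_pullback C h f p q"
    using Fib_pullback_exists[OF assms(1)] Hom_DomCod[OF assms(2)] Hom_DomCod[OF assms(3)] by blast
  show thesis
    using that[OF pb] pullback_square[OF pb assms(3,2)] Fib_pullback[OF assms(1) pb] by blast
qed

text \<open>Compatibility over \<open>one\<close> is automatic. This lets path objects, which live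
  over a product, be treated as the case of base \<open>one\<close> of fibrewise path
  objects.\<close>

lemma pullback_one_product:
  assumes "t \<in> Hom C A one" "is_pullback C t t p q"
  shows "is_product C A A (Dom C p) p q"
proof -
  note pq = pullback_square[OF assms(2,1,1)]
  have "\<exists>!w. w \<in> Hom C T (Dom C p) \<and> p \<cdot> w = u \<and> q \<cdot> w = v"
    if "T \<in> Obj C" "u \<in> Hom C T A" "v \<in> Hom C T A" for T u v
  proof -
    have "t \<cdot> u = t \<cdot> v"
      using to_one_unique[OF Cmp_in_Hom[OF that(2) assms(1)] Cmp_in_Hom[OF that(3) assms(1)]] .
    from pullback_universal[OF assms(2,1,1) that(2,3) this] show ?thesis .
  qed
  then show ?thesis using pq Hom_Obj[OF pq(1)] unfolding is_product_def by blast
qed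

lemma acyclic_cofibration_lift:
  assumes "acyclic_cofibration C Fib i" "i \<in> Hom C A B" "p \<in> Fib" "p \<in> Hom C E X"
    and "u \<in> Hom C A E" "v \<in> Hom C B X" "p \<cdot> u = v \<cdot> i"
  obtains l where "l \<in> Hom C B E" "l \<cdot> i = u" "p \<cdot> l = v"
proof -
  have "left_lifting C i p" using assms(1,3) by (simp add: acyclic_cofibration_def)
  then show thesis
    using assms(5-7) that
    unfolding left_lifting_def Hom_DomCod(1,2)[OF assms(2)] Hom_DomCod(1,2)[OF assms(4)] by blast
qed

lemma acyclic_cofibration_Idn:
  assumes "A \<in> Obj C"
  shows "acyclic_cofibration C Fib (Idn C A)"
proof -
  note i = Idn_in_Hom[OF assms]
  have "left_lifting C (Idn C A) p" if "p \<in> Fib" for p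
    unfolding left_lifting_def Hom_DomCod(1,2)[OF i]
    using Idn_right by metis
  then show ?thesis using Hom_DomCod(3)[OF i] by (simp add: acyclic_cofibration_def)
qed

text \<open>Lift in two stages: first along \<open>i\<close> over \<open>v \<cdot> j\<close>, then
  along \<open>j\<close> with the first lift as the new upper map.\<close>

lemma acyclic_cofibration_Cmp:
  assumes i: "i \<in> Hom C A B" "j \<in> Hom C B D" and a: "acyclic_cofibration C Fib i" "acyclic_cofibration C Fib j"
  shows "acyclic_cofibration C Fib (j \<cdot> i)"
proof -
  note ji = Cmp_in_Hom[OF i]
  have "left_lifting C (j \<cdot> i) p" if p: "p \<in> Fib" for p
    unfolding left_lifting_def Hom_DomCod[OF ji]
  proof (intro ballI impI)
    fix u v
    assume u: "u \<in> Hom C A (Dom C p)" and v: "v \<in> Hom C D (Cod C p)" and sq: "p \<cdot> u = v \<cdot> (j \<cdot> i)"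
    have pH: "p \<in> Hom C (Dom C p) (Cod C p)"
      using p Fib_subcategory by (auto simp: wide_subcategory_def Hom_def)
    have "p \<cdot> u = (v \<cdot> j) \<cdot> i" using sq Cmp_assoc[OF i v] by simp
    then obtain l where l: "l \<in> Hom C B (Dom C p)" "l \<cdot> i = u" "p \<cdot> l = v \<cdot> j"
      using acyclic_cofibration_lift[OF a(1) i(1) p pH u Cmp_in_Hom[OF i(2) v]] by metis
    then obtain m where m: "m \<in> Hom C D (Dom C p)" "m \<cdot> j = l" "p \<cdot> m = v"
      using acyclic_cofibration_lift[OF a(2) i(2) p pH l(1) v] by metis
    then show "\<exists>m\<in>Hom C D (Dom C p). m \<cdot> (j \<cdot> i) = u \<and> p \<cdot> m = v"
      using Cmp_reassoc[OF i m(1,2)] l(2) by blast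
  qed
  then show ?thesis using Hom_DomCod(3)[OF ji] by (simp add: acyclic_cofibration_def)
qed

end

section \<open>Factorizations, and base change of sections that are acyclic cofibrations\<close>

context type_theoretic_fibration_category
begin

abbreviation acof :: "'a \<Rightarrow> bool" where "acof \<equiv> acyclic_cofibration C Fib"

abbreviation htpy :: "'a \<Rightarrow> 'a \<Rightarrow> bool" (infix "\<simeq>" 50) where "u \<simeq> v \<equiv> homotopic C Fib u v"

lemma obtain_factorization:
  assumes "f \<in> Hom C A B"
  obtains P i p where "acof i" "p \<in> Fib" "i \<in> Hom C A P" "p \<in> Hom C P B" "p \<cdot> i = f"
proof -
  obtain i p where ip: "acof i" "p \<in> Fib" "Cod C i = Dom C p" "p \<cdot> i = f"
    using factorization assms Hom_DomCod(3) by blast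
  have "i \<in> Arr C" "p \<in> Arr C"
    using ip Fib_subcategory by (auto simp: acyclic_cofibration_def wide_subcategory_def)
  then have i: "i \<in> Hom C (Dom C i) (Dom C p)" and p: "p \<in> Hom C (Dom C p) (Cod C p)"
    using ip by (auto simp: Hom_def)
  then have "f \<in> Hom C (Dom C i) (Cod C p)" using Cmp_in_Hom ip by blast
  then have "Dom C i = A" "Cod C p = B" using assms by (auto simp: Hom_def)
  then show thesis using that ip i p by blast
qed

text \<open>Regard \<open>r\<close> as a map over \<open>A\<close> from the fibration
  \<open>Idn C A\<close> to \<open>d\<close>. The pullback of \<open>Idn C A\<close> along
  \<open>g\<close> is \<open>Z\<close>, so the base change axiom applies to the induced section
  \<open>j\<close>. With \<open>d\<close> the starting point of paths, \<open>E\<close> is a mapping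
  path object, or an object of composable paths.\<close>

lemma section_pullback:
  assumes d: "d \<in> Fib" "d \<in> Hom C P A" and r: "acof r" "r \<in> Hom C A P" "d \<cdot> r = Idn C A"
    and g: "g \<in> Hom C Z A"
  obtains E j p q where "is_pullback C g d p q" "p \<in> Hom C E Z" "q \<in> Hom C E P" "g \<cdot> p = d \<cdot> q"
    "Dom C p = E" "acof j" "j \<in> Hom C Z E" "p \<cdot> j = Idn C Z" "q \<cdot> j = r \<cdot> g"
proof -
  obtain E p q where pb: "is_pullback C g d p q" "p \<in> Hom C E Z" "q \<in> Hom C E P"
    "g \<cdot> p = d \<cdot> q" "Dom C p = E"
    using obtain_pullback[OF d g] by metis
  note o = Hom_Obj[OF g]
  note i = Idn_in_Hom[OF o(1)] Idn_in_Hom[OF o(2)]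
  have "g \<cdot> Idn C Z = d \<cdot> (r \<cdot> g)"
    using Cmp_reassoc[OF g r(2) d(2) r(3)] Idn_left[OF g] Idn_right[OF g] by simp
  then obtain j where j: "j \<in> Hom C Z E" "p \<cdot> j = Idn C Z" "q \<cdot> j = r \<cdot> g"
    using pullback_lift[OF pb(1) g d(2) i(1) Cmp_in_Hom[OF g r(2)]] pb(5) by metis
  have "acof j"
    using acyclic_cofibration_pullback[OF Fib_Idn[OF o(2)] d(1) r(1) _ _ r(3) pullback_Idn[OF g] pb(1)]
      j r(2) pb(5) by (simp add: Hom_DomCod[OF i(1)] Hom_DomCod[OF i(2)] Hom_DomCod[OF d(2)])
  then show thesis using that pb j by blast
qed

section \<open>Fibrewise homotopies and fibrewise path objects\<close>

text \<open>\<open>Z\<close> plays the role of a path object and \<open>i\<close> that of its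
  constant paths, but both may vary with the homotopy, so no path object has to be fixed in advance.
  The equation \<open>f \<cdot> S = f \<cdot> T\<close> says that the paths run inside the fibres of
  \<open>f\<close>.\<close>

definition fibrewise_homotopic :: "'a \<Rightarrow> 'a \<Rightarrow> 'a \<Rightarrow> bool" where
  "fibrewise_homotopic f u v \<longleftrightarrow> (\<exists>Y Z i S T h. acof i \<and> i \<in> Hom C Y Z \<and>
     S \<in> Hom C Z (Dom C f) \<and> T \<in> Hom C Z (Dom C f) \<and> S \<cdot> i = T \<cdot> i \<and> f \<cdot> S = f \<cdot> T \<and>
     h \<in> Hom C (Dom C u) Z \<and> S \<cdot> h = u \<and> T \<cdot> h = v)"

lemma fibrewise_homotopicI:
  assumes "acof i" "i \<in> Hom C Y Z" "S \<in> Hom C Z A" "T \<in> Hom C Z A" "S \<cdot> i = T \<cdot> i" "f \<cdot> S = f \<cdot> T"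
    "h \<in> Hom C X Z" "f \<in> Hom C A B"
  shows "fibrewise_homotopic f (S \<cdot> h) (T \<cdot> h)"
proof -
  have "Dom C f = A" "Dom C (S \<cdot> h) = X"
    using assms Cmp_in_Hom[OF assms(7,3)] by (auto simp: Hom_def)
  then show ?thesis unfolding fibrewise_homotopic_def using assms by metis
qed

lemma fibrewise_homotopicE:
  assumes "fibrewise_homotopic f u v" "f \<in> Hom C A B" "u \<in> Hom C X A"
  obtains Y Z i S T h where "acof i" "i \<in> Hom C Y Z" "S \<in> Hom C Z A" "T \<in> Hom C Z A"
    "S \<cdot> i = T \<cdot> i" "f \<cdot> S = f \<cdot> T" "h \<in> Hom C X Z" "u = S \<cdot> h" "v = T \<cdot> h"
  using assms(1) unfolding fibrewise_homotopic_def Hom_DomCod[OF assms(2)] Hom_DomCod[OF assms(3)]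
  by blast

text \<open>Lift \<open>i\<close> against \<open>e\<close>: the lower map is the pair
  \<open>(S, T)\<close> into the kernel pair of \<open>f\<close>, the upper map is the family of
  constant paths \<open>r \<cdot> (S \<cdot> i)\<close>. The last equation records the upper
  triangle of the lift.\<close>

lemma path_object_lift:
  assumes f: "f \<in> Hom C A B" and pb: "is_pullback C f f p q"
    and e: "e \<in> Fib" "e \<in> Hom C P (Dom C p)"
    and r: "r \<in> Hom C A P" "p \<cdot> (e \<cdot> r) = Idn C A" "q \<cdot> (e \<cdot> r) = Idn C A"
    and i: "acof i" "i \<in> Hom C Y Z"
    and S: "S \<in> Hom C Z A" and T: "T \<in> Hom C Z A" and eq: "S \<cdot> i = T \<cdot> i" "f \<cdot> S = f \<cdot> T"
  obtains l where "l \<in> Hom C Z P" "p \<cdot> (e \<cdot> l) = S" "q \<cdot> (e \<cdot> l) = T" "l \<cdot> i = r \<cdot> (S \<cdot> i)"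
proof -
  note pq = pullback_square[OF pb f f]
  obtain w where w: "w \<in> Hom C Z (Dom C p)" "p \<cdot> w = S" "q \<cdot> w = T"
    using pullback_lift[OF pb f f S T eq(2)] by blast
  note Si = Cmp_in_Hom[OF i(2) S] and er = Cmp_in_Hom[OF r(1) e(2)]
  note rSi = Cmp_in_Hom[OF Si r(1)]
  have "e \<cdot> (r \<cdot> (S \<cdot> i)) = w \<cdot> i"
  proof (rule pullback_eqI[OF pb f f])
    show "e \<cdot> (r \<cdot> (S \<cdot> i)) \<in> Hom C Y (Dom C p)" "w \<cdot> i \<in> Hom C Y (Dom C p)"
      using Cmp_in_Hom rSi e w i by blast+
    show "p \<cdot> (e \<cdot> (r \<cdot> (S \<cdot> i))) = p \<cdot> (w \<cdot> i)"
      using Cmp_assoc[OF Si r(1) e(2)] Cmp_reassoc[OF Si er pq(1) r(2)] Idn_left[OF Si]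
        Cmp_reassoc[OF i(2) w(1) pq(1) w(2)] by simp
    show "q \<cdot> (e \<cdot> (r \<cdot> (S \<cdot> i))) = q \<cdot> (w \<cdot> i)"
      using Cmp_assoc[OF Si r(1) e(2)] Cmp_reassoc[OF Si er pq(2) r(3)] Idn_left[OF Si]
        Cmp_reassoc[OF i(2) w(1) pq(2) w(3)] eq(1) by simp
  qed
  then obtain l where "l \<in> Hom C Z P" "l \<cdot> i = r \<cdot> (S \<cdot> i)" "e \<cdot> l = w"
    using acyclic_cofibration_lift[OF i e rSi w(1)] by blast
  then show thesis using that w by blast
qed

text \<open>The lift \<open>l\<close> of a witness \<open>Z\<close> into \<open>P\<close> carries
  the homotopy along, so one path object represents all homotopies over the base.\<close>

lemma path_object_homotopy:
  assumes f: "f \<in> Hom C A B" and pb: "is_pullback C f f p q"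
    and e: "e \<in> Fib" "e \<in> Hom C P (Dom C p)"
    and r: "r \<in> Hom C A P" "p \<cdot> (e \<cdot> r) = Idn C A" "q \<cdot> (e \<cdot> r) = Idn C A"
    and uv: "fibrewise_homotopic f u v" and u: "u \<in> Hom C X A"
  obtains h where "h \<in> Hom C X P" "p \<cdot> (e \<cdot> h) = u" "q \<cdot> (e \<cdot> h) = v"
proof -
  note pq = pullback_square[OF pb f f]
  obtain Y Z i S T k where S: "acof i" "i \<in> Hom C Y Z" "S \<in> Hom C Z A" "T \<in> Hom C Z A"
    "S \<cdot> i = T \<cdot> i" "f \<cdot> S = f \<cdot> T" and k: "k \<in> Hom C X Z" "u = S \<cdot> k" "v = T \<cdot> k"
    using fibrewise_homotopicE[OF uv f u] by metis
  obtain l where l: "l \<in> Hom C Z P" "p \<cdot> (e \<cdot> l) = S" "q \<cdot> (e \<cdot> l) = T"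
    using path_object_lift[OF f pb e r S] by metis
  note el = Cmp_in_Hom[OF l(1) e(2)]
  have "p \<cdot> (e \<cdot> (l \<cdot> k)) = u" "q \<cdot> (e \<cdot> (l \<cdot> k)) = v"
    using Cmp_assoc[OF k(1) l(1) e(2)] Cmp_reassoc[OF k(1) el pq(1) l(2)]
      Cmp_reassoc[OF k(1) el pq(2) l(3)] k by auto
  then show thesis using that Cmp_in_Hom[OF k(1) l(1)] by blast
qed

text \<open>Factor the diagonal of \<open>A\<close> into its kernel pair over \<open>B\<close>. The
  starting point \<open>d\<^sub>0\<close> is a fibration because it is \<open>e\<close> followed by
  a pullback of \<open>f\<close>. The last two clauses package lifting into \<open>P\<close>, so
  that \<open>e\<close> and the kernel pair can be forgotten afterwards.\<close>

lemma fibrewise_path_object: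
  assumes f: "f \<in> Fib" "f \<in> Hom C A B"
  obtains P r d\<^sub>0 d\<^sub>1 where "acof r" "r \<in> Hom C A P" "d\<^sub>0 \<in> Fib" "d\<^sub>0 \<in> Hom C P A" "d\<^sub>1 \<in> Hom C P A"
    "d\<^sub>0 \<cdot> r = Idn C A" "d\<^sub>1 \<cdot> r = Idn C A" "f \<cdot> d\<^sub>0 = f \<cdot> d\<^sub>1"
    "\<And>Y Z i S T. acof i \<Longrightarrow> i \<in> Hom C Y Z \<Longrightarrow> S \<in> Hom C Z A \<Longrightarrow> T \<in> Hom C Z A \<Longrightarrow>
       S \<cdot> i = T \<cdot> i \<Longrightarrow> f \<cdot> S = f \<cdot> T \<Longrightarrow>
       \<exists>l \<in> Hom C Z P. d\<^sub>0 \<cdot> l = S \<and> d\<^sub>1 \<cdot> l = T \<and> l \<cdot> i = r \<cdot> (S \<cdot> i)"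
    "\<And>X u v. fibrewise_homotopic f u v \<Longrightarrow> u \<in> Hom C X A \<Longrightarrow>
       \<exists>h \<in> Hom C X P. d\<^sub>0 \<cdot> h = u \<and> d\<^sub>1 \<cdot> h = v"
proof -
  obtain Q p q where pb: "is_pullback C f f p q" "p \<in> Hom C Q A" "q \<in> Hom C Q A" "p \<in> Fib"
    "f \<cdot> p = f \<cdot> q" "Dom C p = Q"
    using obtain_pullback[OF f f(2)] by metis
  note i = Idn_in_Hom[OF Hom_Obj(1)[OF f(2)]]
  obtain \<Delta> where \<Delta>: "\<Delta> \<in> Hom C A Q" "p \<cdot> \<Delta> = Idn C A" "q \<cdot> \<Delta> = Idn C A"
    using pullback_lift[OF pb(1) f(2) f(2) i i refl] pb(6) by metis
  obtain P r e where re: "acof r" "e \<in> Fib" "r \<in> Hom C A P" "e \<in> Hom C P Q" "e \<cdot> r = \<Delta>"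
    using obtain_factorization[OF \<Delta>(1)] by metis
  show thesis
  proof (rule that[of r P "p \<cdot> e" "q \<cdot> e"])
    show "p \<cdot> e \<in> Fib" using Fib_Cmp re pb by blast
    show "p \<cdot> e \<in> Hom C P A" "q \<cdot> e \<in> Hom C P A" using Cmp_in_Hom re pb by blast+
    show "(p \<cdot> e) \<cdot> r = Idn C A" "(q \<cdot> e) \<cdot> r = Idn C A"
      using Cmp_assoc[OF re(3,4)] pb(2,3) re(5) \<Delta> by auto
    show "f \<cdot> p \<cdot> e = f \<cdot> q \<cdot> e"
      using Cmp_assoc[OF re(4) pb(2) f(2)] Cmp_assoc[OF re(4) pb(3) f(2)] pb(5) by simp
    fix Y Z i S T
    assume a: "acof i" "i \<in> Hom C Y Z" "S \<in> Hom C Z A" "T \<in> Hom C Z A" "S \<cdot> i = T \<cdot> i" "f \<cdot> S = f \<cdot> T"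
    obtain l where l: "l \<in> Hom C Z P" "p \<cdot> (e \<cdot> l) = S" "q \<cdot> (e \<cdot> l) = T" "l \<cdot> i = r \<cdot> (S \<cdot> i)"
      using path_object_lift[OF f(2) pb(1) re(2) _ re(3) _ _ a] re pb \<Delta> by metis
    then show "\<exists>l \<in> Hom C Z P. (p \<cdot> e) \<cdot> l = S \<and> (q \<cdot> e) \<cdot> l = T \<and> l \<cdot> i = r \<cdot> (S \<cdot> i)"
      using Cmp_assoc[OF l(1) re(4)] pb(2,3) by auto
  next
    fix X u v
    assume a: "fibrewise_homotopic f u v" "u \<in> Hom C X A"
    obtain h where h: "h \<in> Hom C X P" "p \<cdot> (e \<cdot> h) = u" "q \<cdot> (e \<cdot> h) = v"
      using path_object_homotopy[OF f(2) pb(1) re(2) _ re(3) _ _ a] re pb \<Delta> by metis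
    then show "\<exists>h \<in> Hom C X P. (p \<cdot> e) \<cdot> h = u \<and> (q \<cdot> e) \<cdot> h = v"
      using Cmp_assoc[OF h(1) re(4)] pb(2,3) by auto
  qed (use re in auto)
qed

lemma fibrewise_homotopic_sym:
  assumes "fibrewise_homotopic f u v" "f \<in> Hom C A B" "u \<in> Hom C X A"
  shows "fibrewise_homotopic f v u"
  using fibrewise_homotopicE[OF assms] fibrewise_homotopicI[OF _ _ _ _ _ _ _ assms(2)] by metis

lemma fibrewise_homotopic_trans:
  assumes f: "f \<in> Fib" "f \<in> Hom C A B" and u: "u \<in> Hom C X A"
    and uv: "fibrewise_homotopic f u v" and vw: "fibrewise_homotopic f v w"
  shows "fibrewise_homotopic f u w"
proof -
  obtain P r d0 d1 where P: "acof r" "r \<in> Hom C A P" "d0 \<in> Fib" "d0 \<in> Hom C P A" "d1 \<in> Hom C P A"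
    "d0 \<cdot> r = Idn C A" "d1 \<cdot> r = Idn C A" "f \<cdot> d0 = f \<cdot> d1"
    and to_P: "\<And>X u v. fibrewise_homotopic f u v \<Longrightarrow> u \<in> Hom C X A \<Longrightarrow>
       \<exists>h \<in> Hom C X P. d0 \<cdot> h = u \<and> d1 \<cdot> h = v"
    by (rule fibrewise_path_object[OF f]) (rule that)
  obtain h where h: "h \<in> Hom C X P" "d0 \<cdot> h = u" "d1 \<cdot> h = v" using to_P[OF uv u] by blast
  have v: "v \<in> Hom C X A" using Cmp_in_Hom h P by blast
  obtain k where k: "k \<in> Hom C X P" "d0 \<cdot> k = v" "d1 \<cdot> k = w" using to_P[OF vw v] by blast
  \<comment> \<open>\<open>E\<close> is the object of composable pairs of paths: \<open>p\<close>
    ends where \<open>q\<close> starts. The section \<open>j\<close> appends a constant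
    path.\<close>
  obtain E j p q where E: "is_pullback C d1 d0 p q" "p \<in> Hom C E P" "q \<in> Hom C E P"
    "d1 \<cdot> p = d0 \<cdot> q" "Dom C p = E" "acof j" "j \<in> Hom C P E" "p \<cdot> j = Idn C P" "q \<cdot> j = r \<cdot> d1"
    using section_pullback[OF P(3,4,1,2,6,5)] by metis
  obtain m where m: "m \<in> Hom C X E" "p \<cdot> m = h" "q \<cdot> m = k"
    using pullback_lift[OF E(1) P(5,4) h(1) k(1)] h k E(5) by metis
  have S: "d0 \<cdot> p \<in> Hom C E A" and T: "d1 \<cdot> q \<in> Hom C E A" using Cmp_in_Hom P E by blast+
  \<comment> \<open>On the image of \<open>j\<close> the second path is constant, so the outer
    endpoints of the pair are those of the first path. Restricting further along \<open>r\<close>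
    makes both endpoints agree, which shows \<open>E\<close> with \<open>j \<cdot> r\<close> to be a
    valid witness.\<close>
  have "(d0 \<cdot> p) \<cdot> j = d0"
    using Cmp_assoc[OF E(7,2) P(4)] E(8) Idn_right[OF P(4)] by simp
  moreover have "(d1 \<cdot> q) \<cdot> j = d1"
    using Cmp_assoc[OF E(7,3) P(5)] E(9) Cmp_reassoc[OF P(5,2,5,7)] Idn_left[OF P(5)] by simp
  ultimately have eq: "(d0 \<cdot> p) \<cdot> (j \<cdot> r) = (d1 \<cdot> q) \<cdot> (j \<cdot> r)"
    using Cmp_reassoc[OF P(2) E(7) S] Cmp_reassoc[OF P(2) E(7) T] P(6,7) by simp
  have fS: "f \<cdot> (d0 \<cdot> p) = f \<cdot> (d1 \<cdot> q)"
    using Cmp_assoc[OF E(2) P(4) f(2)] Cmp_assoc[OF E(2) P(5) f(2)] Cmp_assoc[OF E(3) P(4) f(2)]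
      Cmp_assoc[OF E(3) P(5) f(2)] P(8) E(4) by simp
  have "fibrewise_homotopic f ((d0 \<cdot> p) \<cdot> m) ((d1 \<cdot> q) \<cdot> m)"
    using fibrewise_homotopicI[OF acyclic_cofibration_Cmp[OF P(2) E(7) P(1) E(6)]
      Cmp_in_Hom[OF P(2) E(7)] S T eq fS m(1) f(2)] .
  then show ?thesis
    using Cmp_assoc[OF m(1) E(2) P(4)] Cmp_assoc[OF m(1) E(3) P(5)] m h k by simp
qed

section \<open>The homotopy relation and its compatibility with composition\<close>

text \<open>A path object is itself a witness, with \<open>S\<close> and \<open>T\<close> its two
  endpoint maps. Conversely, a witness lifts into the path object obtained by factoring the diagonal
  into the pullback over \<open>one\<close>.\<close>

lemma homotopic_iff_fibrewise:
  assumes "t \<in> Hom C A one" "t \<in> Fib" and u: "u \<in> Hom C X A" and v: "v \<in> Hom C X A"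
  shows "u \<simeq> v \<longleftrightarrow> fibrewise_homotopic t u v"
proof
  assume "u \<simeq> v"
  then obtain Q p q r e h where *: "path_object C Fib A Q p q r e" "h \<in> Hom C X (Dom C e)"
    "e \<cdot> h = pairing C p q u v"
    using u v unfolding homotopic_def by (auto simp: Hom_def)
  then have prod: "is_product C A A Q p q" and re: "acof r" "r \<in> Hom C A (Dom C e)"
    "e \<in> Hom C (Dom C e) Q" "e \<cdot> r = diagonal C A p q"
    by (auto simp: path_object_def)
  then have pq: "p \<in> Hom C Q A" "q \<in> Hom C Q A" by (auto simp: is_product_def)
  note i = Idn_in_Hom[OF Hom_Obj(1)[OF assms(1)]]
  note pi = pairing_product[OF prod i i, folded diagonal_def]
  note pe = Cmp_in_Hom[OF re(3) pq(1)] and qe = Cmp_in_Hom[OF re(3) pq(2)]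
  have "(p \<cdot> e) \<cdot> r = (q \<cdot> e) \<cdot> r"
    using Cmp_assoc[OF re(2,3) pq(1)] Cmp_assoc[OF re(2,3) pq(2)] re(4) pi by simp
  moreover have "t \<cdot> (p \<cdot> e) = t \<cdot> (q \<cdot> e)"
    using to_one_unique Cmp_in_Hom[OF pe assms(1)] Cmp_in_Hom[OF qe assms(1)] by blast
  ultimately have "fibrewise_homotopic t ((p \<cdot> e) \<cdot> h) ((q \<cdot> e) \<cdot> h)"
    using fibrewise_homotopicI[OF re(1,2) pe qe] *(2) assms(1) by blast
  then show "fibrewise_homotopic t u v"
    using Cmp_assoc[OF *(2) re(3) pq(1)] Cmp_assoc[OF *(2) re(3) pq(2)] *(3)
      pairing_product[OF prod u v] by simp
next
  assume uv: "fibrewise_homotopic t u v"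
  obtain Q p q where pb: "is_pullback C t t p q" "p \<in> Hom C Q A" "q \<in> Hom C Q A" "Dom C p = Q"
    using obtain_pullback[OF assms(2,1,1)] by metis
  have prod: "is_product C A A Q p q" using pullback_one_product[OF assms(1) pb(1)] pb by simp
  note i = Idn_in_Hom[OF Hom_Obj(1)[OF assms(1)]]
  note pi = pairing_product[OF prod i i, folded diagonal_def]
  obtain P r e where re: "acof r" "e \<in> Fib" "r \<in> Hom C A P" "e \<in> Hom C P Q" "e \<cdot> r = diagonal C A p q"
    using obtain_factorization[OF pi(1)] by metis
  obtain h where h: "h \<in> Hom C X P" "p \<cdot> (e \<cdot> h) = u" "q \<cdot> (e \<cdot> h) = v"
    using path_object_homotopy[OF assms(1) pb(1) re(2) _ re(3) _ _ uv u] re pb pi by metis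
  have "e \<cdot> h = pairing C p q u v"
    using pairing_eqI[OF prod Cmp_in_Hom[OF h(1) re(4)] h(2,3)] .
  moreover have "path_object C Fib A Q p q r e"
    using re prod by (simp add: path_object_def Hom_DomCod[OF re(4)])
  ultimately show "u \<simeq> v"
    unfolding homotopic_def Hom_DomCod[OF u] Hom_DomCod[OF v]
    using Hom_DomCod[OF u] Hom_DomCod[OF v] Hom_DomCod(1)[OF re(4)] h(1) by metis
qed

text \<open>Over \<open>one\<close> the fibre condition on \<open>S\<close> and \<open>T\<close>
  holds automatically, which leaves only their agreement on \<open>i\<close>.\<close>

lemma homotopicI:
  assumes "acof i" "i \<in> Hom C Y Z" "S \<in> Hom C Z A" "T \<in> Hom C Z A" "S \<cdot> i = T \<cdot> i" "h \<in> Hom C X Z"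
  shows "S \<cdot> h \<simeq> T \<cdot> h"
proof -
  obtain t where t: "t \<in> Hom C A one" "t \<in> Fib" using obtain_to_one Hom_Obj(2)[OF assms(3)] by metis
  have "t \<cdot> S = t \<cdot> T" using to_one_unique Cmp_in_Hom assms(3,4) t(1) by blast
  then show ?thesis
    using homotopic_iff_fibrewise[OF t Cmp_in_Hom[OF assms(6,3)] Cmp_in_Hom[OF assms(6,4)]]
      fibrewise_homotopicI[OF assms(1-5) _ assms(6) t(1)] by simp
qed

lemma homotopic_Hom: "u \<simeq> v \<Longrightarrow> u \<in> Hom C X A \<Longrightarrow> v \<in> Hom C X A"
  by (auto simp: homotopic_def Hom_def)

lemma homotopic_refl:
  assumes "u \<in> Hom C X A"
  shows "u \<simeq> u"
proof -
  note i = Idn_in_Hom[OF Hom_Obj(1)[OF assms]]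
  show ?thesis
    using homotopicI[OF acyclic_cofibration_Idn[OF Hom_Obj(1)[OF assms]] i assms assms refl i]
      Idn_right[OF assms] by simp
qed

lemma homotopicE:
  assumes "u \<simeq> v" "u \<in> Hom C X A"
  obtains Y Z i S T h where "acof i" "i \<in> Hom C Y Z" "S \<in> Hom C Z A" "T \<in> Hom C Z A"
    "S \<cdot> i = T \<cdot> i" "h \<in> Hom C X Z" "u = S \<cdot> h" "v = T \<cdot> h"
proof -
  obtain t where t: "t \<in> Hom C A one" "t \<in> Fib" using obtain_to_one Hom_Obj(2)[OF assms(2)] by metis
  show thesis
    using fibrewise_homotopicE[OF iffD1[OF homotopic_iff_fibrewise[OF t assms(2) homotopic_Hom[OF assms]] assms(1)]
      t(1) assms(2)] that by metis
qed

lemma homotopic_sym: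
  assumes "u \<simeq> v"
  shows "v \<simeq> u"
proof -
  have "u \<in> Hom C (Dom C u) (Cod C u)" using assms by (auto simp: homotopic_def Hom_def)
  then show ?thesis using homotopicE[OF assms] homotopicI by metis
qed

lemma homotopic_trans [trans]:
  assumes "u \<simeq> v" "v \<simeq> w"
  shows "u \<simeq> w"
proof -
  let ?X = "Dom C u" and ?A = "Cod C u"
  have u: "u \<in> Hom C ?X ?A" using assms by (auto simp: homotopic_def Hom_def)
  note v = homotopic_Hom[OF assms(1) u]
  note w = homotopic_Hom[OF assms(2) v]
  obtain t where t: "t \<in> Hom C ?A one" "t \<in> Fib" using obtain_to_one Hom_Obj(2)[OF u] by metis
  show ?thesis
    using fibrewise_homotopic_trans[OF t(2,1) u, of v w] assms
    unfolding homotopic_iff_fibrewise[OF t u v] homotopic_iff_fibrewise[OF t v w]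
      homotopic_iff_fibrewise[OF t u w] by blast
qed

lemma homotopic_Cmp_right:
  assumes "u \<simeq> v" "u \<in> Hom C X A" "k \<in> Hom C W X"
  shows "u \<cdot> k \<simeq> v \<cdot> k"
proof -
  obtain Y Z i S T h where h: "acof i" "i \<in> Hom C Y Z" "S \<in> Hom C Z A" "T \<in> Hom C Z A"
    "S \<cdot> i = T \<cdot> i" "h \<in> Hom C X Z" "u = S \<cdot> h" "v = T \<cdot> h"
    using homotopicE[OF assms(1,2)] by metis
  show ?thesis
    using homotopicI[OF h(1-5) Cmp_in_Hom[OF assms(3) h(6)]]
      Cmp_assoc[OF assms(3) h(6,3)] Cmp_assoc[OF assms(3) h(6,4)] h by simp
qed

text \<open>Postcomposition changes only \<open>S\<close> and \<open>T\<close>, which still agree on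
  \<open>i\<close>; no map between path objects has to be constructed.\<close>

lemma homotopic_Cmp_left:
  assumes "u \<simeq> v" "u \<in> Hom C X A" "k \<in> Hom C A D"
  shows "k \<cdot> u \<simeq> k \<cdot> v"
proof -
  obtain Y Z i S T h where h: "acof i" "i \<in> Hom C Y Z" "S \<in> Hom C Z A" "T \<in> Hom C Z A"
    "S \<cdot> i = T \<cdot> i" "h \<in> Hom C X Z" "u = S \<cdot> h" "v = T \<cdot> h"
    using homotopicE[OF assms(1,2)] by metis
  have "(k \<cdot> S) \<cdot> i = (k \<cdot> T) \<cdot> i"
    using Cmp_assoc[OF h(2,3) assms(3)] Cmp_assoc[OF h(2,4) assms(3)] h(5) by simp
  then show ?thesis
    using homotopicI[OF h(1,2) Cmp_in_Hom[OF h(3) assms(3)] Cmp_in_Hom[OF h(4) assms(3)] _ h(6)]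
      Cmp_assoc[OF h(6,3) assms(3)] Cmp_assoc[OF h(6,4) assms(3)] h by simp
qed

section \<open>Homotopy equivalences and two-out-of-three\<close>

lemma homotopy_equivalence_iff:
  assumes "f \<in> Hom C X Y"
  shows "homotopy_equivalence C Fib f \<longleftrightarrow> (\<exists>g \<in> Hom C Y X. g \<cdot> f \<simeq> Idn C X \<and> f \<cdot> g \<simeq> Idn C Y)"
  unfolding homotopy_equivalence_def Hom_DomCod(1,2)[OF assms] using Hom_DomCod(3)[OF assms] by simp

lemma homotopy_equivalence_Cmp:
  assumes f: "f \<in> Hom C X Y" "homotopy_equivalence C Fib f"
    and g: "g \<in> Hom C Y Z" "homotopy_equivalence C Fib g"
  shows "homotopy_equivalence C Fib (g \<cdot> f)"
proof -
  \<comment> \<open>One of the two identities for a composite; the other is the same claim for the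
    inverses \<open>g'\<close> and \<open>f'\<close> in the opposite order.\<close>
  have cancel: "(b \<cdot> d) \<cdot> (c \<cdot> a) \<simeq> Idn C U"
    if a: "a \<in> Hom C U V" and b: "b \<in> Hom C V U" and c: "c \<in> Hom C V W" and d: "d \<in> Hom C W V"
      and ba: "b \<cdot> a \<simeq> Idn C U" and dc: "d \<cdot> c \<simeq> Idn C V" for a b c d U V W
  proof -
    note ca = Cmp_in_Hom[OF a c]
    note dca = Cmp_in_Hom[OF ca d]
    have "d \<cdot> (c \<cdot> a) \<simeq> a"
      using homotopic_Cmp_right[OF dc Cmp_in_Hom[OF c d] a] Cmp_assoc[OF a c d] Idn_left[OF a] by simp
    then have "b \<cdot> (d \<cdot> (c \<cdot> a)) \<simeq> b \<cdot> a" using homotopic_Cmp_left[OF _ dca b] by simp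
    then show ?thesis using homotopic_trans[OF _ ba] Cmp_assoc[OF ca d b] by simp
  qed
  obtain f' where f': "f' \<in> Hom C Y X" "f' \<cdot> f \<simeq> Idn C X" "f \<cdot> f' \<simeq> Idn C Y"
    using f homotopy_equivalence_iff by blast
  obtain g' where g': "g' \<in> Hom C Z Y" "g' \<cdot> g \<simeq> Idn C Y" "g \<cdot> g' \<simeq> Idn C Z"
    using g homotopy_equivalence_iff by blast
  show ?thesis
    unfolding homotopy_equivalence_iff[OF Cmp_in_Hom[OF f(1) g(1)]]
    using cancel[OF f(1) f'(1) g(1) g'(1) f'(2) g'(2)] cancel[OF g'(1) g(1) f'(1) f(1) g'(3) f'(3)]
      Cmp_in_Hom[OF g'(1) f'(1)] by blast
qed

text \<open>Composing with a homotopy inverse of \<open>g\<close> undoes \<open>g\<close> up to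
  homotopy. In two-out-of-three this yields the identity that is not given directly.\<close>

lemma homotopy_equivalence_left_cancel:
  assumes "homotopy_equivalence C Fib g" "g \<in> Hom C Y Z" and u: "u \<in> Hom C X Y" and v: "v \<in> Hom C X Y"
    and eq: "g \<cdot> u \<simeq> g \<cdot> v"
  shows "u \<simeq> v"
proof -
  obtain k where k: "k \<in> Hom C Z Y" "k \<cdot> g \<simeq> Idn C Y"
    using assms(1,2) homotopy_equivalence_iff by blast
  have inv: "k \<cdot> (g \<cdot> w) \<simeq> w" if "w \<in> Hom C X Y" for w
    using homotopic_Cmp_right[OF k(2) Cmp_in_Hom[OF assms(2) k(1)] that]
      Cmp_assoc[OF that assms(2) k(1)] Idn_left[OF that] by simp
  show ?thesis
    using homotopic_trans[OF homotopic_sym[OF inv[OF u]]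
        homotopic_trans[OF homotopic_Cmp_left[OF eq Cmp_in_Hom[OF u assms(2)] k(1)] inv[OF v]]] .
qed

lemma homotopy_equivalence_right_cancel:
  assumes "homotopy_equivalence C Fib f" "f \<in> Hom C X Y" and u: "u \<in> Hom C Y Z" and v: "v \<in> Hom C Y Z"
    and eq: "u \<cdot> f \<simeq> v \<cdot> f"
  shows "u \<simeq> v"
proof -
  obtain k where k: "k \<in> Hom C Y X" "f \<cdot> k \<simeq> Idn C Y"
    using assms(1,2) homotopy_equivalence_iff by blast
  have inv: "(w \<cdot> f) \<cdot> k \<simeq> w" if "w \<in> Hom C Y Z" for w
    using homotopic_Cmp_left[OF k(2) Cmp_in_Hom[OF k(1) assms(2)] that]
      Cmp_assoc[OF k(1) assms(2) that] Idn_right[OF that] by simp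
  show ?thesis
    using homotopic_trans[OF homotopic_sym[OF inv[OF u]]
        homotopic_trans[OF homotopic_Cmp_right[OF eq Cmp_in_Hom[OF assms(2) u] k(1)] inv[OF v]]] .
qed

text \<open>With \<open>k\<close> inverse to \<open>g \<cdot> f\<close>, the inverse of
  \<open>f\<close> is \<open>k \<cdot> g\<close>. One identity is that of \<open>k\<close>; the
  other holds after composing with \<open>g\<close>, which can be cancelled.\<close>

lemma homotopy_equivalence_cancel_left:
  assumes f: "f \<in> Hom C X Y" and g: "g \<in> Hom C Y Z"
    and "homotopy_equivalence C Fib g" "homotopy_equivalence C Fib (g \<cdot> f)"
  shows "homotopy_equivalence C Fib f"
proof -
  note gf = Cmp_in_Hom[OF f g]
  obtain k where k: "k \<in> Hom C Z X" "k \<cdot> (g \<cdot> f) \<simeq> Idn C X" "(g \<cdot> f) \<cdot> k \<simeq> Idn C Z"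
    using assms(4) homotopy_equivalence_iff[OF gf] by blast
  note kg = Cmp_in_Hom[OF g k(1)]
  have "g \<cdot> (f \<cdot> (k \<cdot> g)) \<simeq> g \<cdot> Idn C Y"
    using homotopic_Cmp_right[OF k(3) Cmp_in_Hom[OF k(1) gf] g] Cmp_assoc[OF g k(1) gf]
      Cmp_assoc[OF kg f g] Idn_left[OF g] Idn_right[OF g] by simp
  then have "f \<cdot> (k \<cdot> g) \<simeq> Idn C Y"
    using homotopy_equivalence_left_cancel[OF assms(3) g Cmp_in_Hom[OF kg f]]
      Idn_in_Hom[OF Hom_Obj(2)[OF f]] by blast
  moreover have "(k \<cdot> g) \<cdot> f \<simeq> Idn C X" using k(2) Cmp_assoc[OF f g k(1)] by simp
  ultimately show ?thesis using homotopy_equivalence_iff[OF f] kg by blast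
qed

text \<open>Dually, the inverse of \<open>g\<close> is \<open>f \<cdot> k\<close>, and
  \<open>f\<close> is cancelled on the right.\<close>

lemma homotopy_equivalence_cancel_right:
  assumes f: "f \<in> Hom C X Y" and g: "g \<in> Hom C Y Z"
    and "homotopy_equivalence C Fib f" "homotopy_equivalence C Fib (g \<cdot> f)"
  shows "homotopy_equivalence C Fib g"
proof -
  note gf = Cmp_in_Hom[OF f g]
  obtain k where k: "k \<in> Hom C Z X" "k \<cdot> (g \<cdot> f) \<simeq> Idn C X" "(g \<cdot> f) \<cdot> k \<simeq> Idn C Z"
    using assms(4) homotopy_equivalence_iff[OF gf] by blast
  note fk = Cmp_in_Hom[OF k(1) f]
  have "((f \<cdot> k) \<cdot> g) \<cdot> f \<simeq> Idn C Y \<cdot> f"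
    using homotopic_Cmp_left[OF k(2) Cmp_in_Hom[OF gf k(1)] f] Cmp_assoc[OF gf k(1) f]
      Cmp_assoc[OF f g fk] Idn_left[OF f] Idn_right[OF f] by simp
  then have "(f \<cdot> k) \<cdot> g \<simeq> Idn C Y"
    using homotopy_equivalence_right_cancel[OF assms(3) f Cmp_in_Hom[OF g fk]]
      Idn_in_Hom[OF Hom_Obj(2)[OF f]] by blast
  moreover have "g \<cdot> (f \<cdot> k) \<simeq> Idn C Z" using k(3) Cmp_assoc[OF k(1) f g] by simp
  ultimately show ?thesis using homotopy_equivalence_iff[OF g] fk by blast
qed

lemma iso_homotopy_equivalence:
  assumes "is_iso C f"
  shows "homotopy_equivalence C Fib f"
proof -
  obtain g where f: "f \<in> Hom C (Dom C f) (Cod C f)" and g: "g \<in> Hom C (Cod C f) (Dom C f)"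
    and gf: "g \<cdot> f = Idn C (Dom C f)" "f \<cdot> g = Idn C (Cod C f)"
    using assms by (auto simp: is_iso_def Hom_def)
  show ?thesis
    using homotopy_equivalence_iff[OF f] g homotopic_refl[OF Idn_in_Hom[OF Hom_Obj(1)[OF f]]]
      homotopic_refl[OF Idn_in_Hom[OF Hom_Obj(2)[OF f]]] unfolding gf[symmetric] by blast
qed

text \<open>Lifting against the fibration \<open>A \<rightarrow> one\<close> gives a retraction
  \<open>l\<close>. Then \<open>i \<cdot> l\<close> and the identity agree on \<open>i\<close>, so
  \<open>i\<close> itself witnesses that they are homotopic.\<close>

lemma acyclic_cofibration_homotopy_equivalence:
  assumes i: "acof i" "i \<in> Hom C A B"
  shows "homotopy_equivalence C Fib i"
proof -
  note A = Idn_in_Hom[OF Hom_Obj(1)[OF i(2)]] and B = Idn_in_Hom[OF Hom_Obj(2)[OF i(2)]]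
  obtain t where t: "t \<in> Hom C A one" "t \<in> Fib" using obtain_to_one Hom_Obj(1)[OF i(2)] by metis
  obtain t' where t': "t' \<in> Hom C B one" using obtain_to_one Hom_Obj(2)[OF i(2)] by metis
  have "t \<cdot> Idn C A = t' \<cdot> i"
    using to_one_unique[OF Cmp_in_Hom[OF A t(1)] Cmp_in_Hom[OF i(2) t']] .
  then obtain l where l: "l \<in> Hom C B A" "l \<cdot> i = Idn C A"
    using acyclic_cofibration_lift[OF i t(2,1) A t'] by blast
  note il = Cmp_in_Hom[OF l(1) i(2)]
  have "(i \<cdot> l) \<cdot> i = Idn C B \<cdot> i"
    using Cmp_assoc[OF i(2) l(1) i(2)] l(2) Idn_left[OF i(2)] Idn_right[OF i(2)] by simp
  then have "i \<cdot> l \<simeq> Idn C B"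
    using homotopicI[OF i il B _ B] Idn_right[OF il] Idn_right[OF B] by simp
  moreover have "l \<cdot> i \<simeq> Idn C A" using l(2) homotopic_refl[OF A] by simp
  ultimately show ?thesis using homotopy_equivalence_iff[OF i(2)] l(1) by blast
qed

section \<open>Acyclic fibrations: strict sections and contraction over the base\<close>

text \<open>A strict section with a homotopy over \<open>B\<close> consists of data over
  \<open>B\<close> and hence survives base change, unlike a bare homotopy inverse.\<close>

lemma acyclic_fibration_section:
  assumes f: "f \<in> Fib" "f \<in> Hom C A B" and he: "homotopy_equivalence C Fib f"
  obtains s where "s \<in> Hom C B A" "f \<cdot> s = Idn C B" "fibrewise_homotopic f (s \<cdot> f) (Idn C A)"
proof -
  note A = Idn_in_Hom[OF Hom_Obj(1)[OF f(2)]] and B = Idn_in_Hom[OF Hom_Obj(2)[OF f(2)]]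
  obtain g where g: "g \<in> Hom C B A" "g \<cdot> f \<simeq> Idn C A" "f \<cdot> g \<simeq> Idn C B"
    using he homotopy_equivalence_iff[OF f(2)] by blast
  obtain t where t: "t \<in> Hom C B one" "t \<in> Fib" using obtain_to_one Hom_Obj(2)[OF f(2)] by metis
  obtain P r d0 d1 where P: "acof r" "r \<in> Hom C B P" "d0 \<in> Fib" "d0 \<in> Hom C P B" "d1 \<in> Hom C P B"
    "d0 \<cdot> r = Idn C B" "d1 \<cdot> r = Idn C B" "t \<cdot> d0 = t \<cdot> d1"
    and P_lift: "\<And>Y Z i S T. acof i \<Longrightarrow> i \<in> Hom C Y Z \<Longrightarrow> S \<in> Hom C Z B \<Longrightarrow> T \<in> Hom C Z B \<Longrightarrow>
       S \<cdot> i = T \<cdot> i \<Longrightarrow> t \<cdot> S = t \<cdot> T \<Longrightarrow>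
       \<exists>l \<in> Hom C Z P. d0 \<cdot> l = S \<and> d1 \<cdot> l = T \<and> l \<cdot> i = r \<cdot> (S \<cdot> i)"
    and to_P: "\<And>X u v. fibrewise_homotopic t u v \<Longrightarrow> u \<in> Hom C X B \<Longrightarrow>
       \<exists>h \<in> Hom C X P. d0 \<cdot> h = u \<and> d1 \<cdot> h = v"
    by (rule fibrewise_path_object[OF t(2,1)]) (rule that)
  \<comment> \<open>\<open>W\<close> is the mapping path object of \<open>f\<close>: a point
    \<open>a\<close> of \<open>A\<close> with a path in \<open>B\<close> starting at
    \<open>f a\<close>. The section \<open>j\<close> picks the constant path.\<close>
  obtain W j p q where W: "is_pullback C f d0 p q" "p \<in> Hom C W A" "q \<in> Hom C W P"
    "f \<cdot> p = d0 \<cdot> q" "Dom C p = W" "acof j" "j \<in> Hom C A W" "p \<cdot> j = Idn C A" "q \<cdot> j = r \<cdot> f"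
    using section_pullback[OF P(3,4,1,2,6) f(2)] by metis
  have into_W: "\<exists>w \<in> Hom C X W. p \<cdot> w = u \<and> q \<cdot> w = v"
    if "u \<in> Hom C X A" "v \<in> Hom C X P" "f \<cdot> u = d0 \<cdot> v" for X u v
    using pullback_lift[OF W(1) f(2) P(4) that] W(5) by metis
  have W_eqI: "w = w'" if "w \<in> Hom C X W" "w' \<in> Hom C X W" "p \<cdot> w = p \<cdot> w'" "q \<cdot> w = q \<cdot> w'" for X w w'
    using pullback_eqI[OF W(1) f(2) P(4), unfolded W(5), OF that] .
  have "f \<cdot> Idn C A = (d1 \<cdot> q) \<cdot> j"
    using Cmp_assoc[OF W(7,3) P(5)] W(9) Cmp_reassoc[OF f(2) P(2,5,7)] Idn_left[OF f(2)]
      Idn_right[OF f(2)] by simp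
  \<comment> \<open>Transport: lifting \<open>j\<close> against \<open>f\<close> produces, for a
    point and a path, a point over the end of the path, and does nothing along constant
    paths.\<close>
  then obtain \<tau> where \<tau>: "\<tau> \<in> Hom C W A" "\<tau> \<cdot> j = Idn C A" "f \<cdot> \<tau> = d1 \<cdot> q"
    using acyclic_cofibration_lift[OF W(6,7) f A Cmp_in_Hom[OF W(3) P(5)]] by metis
  have f\<tau>: "f \<cdot> (\<tau> \<cdot> w) = d1 \<cdot> (q \<cdot> w)" if "w \<in> Hom C X W" for X w
    using Cmp_assoc[OF that \<tau>(1) f(2)] Cmp_assoc[OF that W(3) P(5)] \<tau>(3) by simp

  obtain h where h: "h \<in> Hom C B P" "d0 \<cdot> h = f \<cdot> g" "d1 \<cdot> h = Idn C B"
    using to_P g(3) homotopic_iff_fibrewise[OF t Cmp_in_Hom[OF g(1) f(2)] B] Cmp_in_Hom[OF g(1) f(2)] by blast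
  obtain w where w: "w \<in> Hom C B W" "p \<cdot> w = g" "q \<cdot> w = h"
    using into_W[OF g(1) h(1)] h(2) by auto
  \<comment> \<open>The point \<open>g b\<close> lies over \<open>f (g b)\<close>; transporting it
    along the path \<open>h\<close> from there to \<open>b\<close> puts it strictly over
    \<open>b\<close>.\<close>
  define s where "s = \<tau> \<cdot> w"
  have s: "s \<in> Hom C B A" unfolding s_def using Cmp_in_Hom[OF w(1) \<tau>(1)] .
  have fs: "f \<cdot> s = Idn C B" unfolding s_def using f\<tau>[OF w(1)] w h by simp
  note sf = Cmp_in_Hom[OF f(2) s]
  \<comment> \<open>Transport \<open>\<tau>\<close> and the projection \<open>p\<close> agree on
    \<open>j\<close>, so a point is homotopic to its transport.\<close>
  have "s \<simeq> g"
    unfolding s_def using homotopicI[OF W(6,7) \<tau>(1) W(2) _ w(1)] \<tau>(2) W(8) w(2) by simp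
  then have "s \<cdot> f \<simeq> Idn C A"
    using homotopic_trans[OF homotopic_Cmp_right[OF _ s f(2)] g(2)] by blast

  txt \<open>
    Let \<open>H\<close> be a homotopy from \<open>s f\<close> to \<open>1\<close>, and write \<open>\<tau>(a, \<gamma>)\<close> for the transport of \<open>a\<close>
    along the path \<open>\<gamma>\<close> in \<open>B\<close>. Both steps of \<open>s f a \<sim> \<tau>(s f a, f H a) \<sim> a\<close> are homotopies
    over \<open>B\<close>: the first holds for every path \<open>\<gamma>\<close> from \<open>b\<close> to \<open>b'\<close> in the form
    \<open>\<tau>(s b, \<gamma>) \<sim> s b'\<close>, the second for every path \<open>\<gamma>\<close> from \<open>a\<close> to \<open>a'\<close> in the form
    \<open>\<tau>(a, f \<gamma>) \<sim> a'\<close>, since both are equalities on constant paths.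
  \<close>
  obtain t' where t': "t' \<in> Hom C A one" "t' \<in> Fib" using obtain_to_one Hom_Obj(1)[OF f(2)] by metis
  obtain R r' e0 e1 where R: "acof r'" "r' \<in> Hom C A R" "e0 \<in> Fib" "e0 \<in> Hom C R A" "e1 \<in> Hom C R A"
    "e0 \<cdot> r' = Idn C A" "e1 \<cdot> r' = Idn C A"
    and to_R: "\<And>X u v. fibrewise_homotopic t' u v \<Longrightarrow> u \<in> Hom C X A \<Longrightarrow>
       \<exists>h \<in> Hom C X R. e0 \<cdot> h = u \<and> e1 \<cdot> h = v"
    by (rule fibrewise_path_object[OF t'(2,1)]) (rule that)
  obtain H where H: "H \<in> Hom C A R" "e0 \<cdot> H = s \<cdot> f" "e1 \<cdot> H = Idn C A"
    using to_R \<open>s \<cdot> f \<simeq> Idn C A\<close> homotopic_iff_fibrewise[OF t' sf A] sf by blast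
  note fe = Cmp_in_Hom[OF R(4) f(2)] Cmp_in_Hom[OF R(5) f(2)]
  have fer: "(f \<cdot> e0) \<cdot> r' = f" "(f \<cdot> e1) \<cdot> r' = f"
    using Cmp_assoc[OF R(2,4) f(2)] Cmp_assoc[OF R(2,5) f(2)] R(6,7) Idn_right[OF f(2)] by auto
  \<comment> \<open>\<open>F\<close> is the action of \<open>f\<close> on paths, chosen so as to
    send constant paths to constant paths.\<close>
  obtain F where F: "F \<in> Hom C R P" "d0 \<cdot> F = f \<cdot> e0" "d1 \<cdot> F = f \<cdot> e1" "F \<cdot> r' = r \<cdot> f"
    using P_lift[OF R(1,2) fe] fer to_one_unique[OF Cmp_in_Hom[OF fe(1) t(1)] Cmp_in_Hom[OF fe(2) t(1)]]
    by auto
  note FH = Cmp_in_Hom[OF H(1) F(1)]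

  \<comment> \<open>\<open>m\<close> sends a path in \<open>A\<close> to its starting point together
    with its image in \<open>B\<close>; constant paths go to \<open>j\<close>.\<close>
  obtain m where m: "m \<in> Hom C R W" "p \<cdot> m = e0" "q \<cdot> m = F"
    using into_W[OF R(4) F(1)] F(2) by auto
  have "m \<cdot> r' = j"
    using W_eqI[OF Cmp_in_Hom[OF R(2) m(1)] W(7)] Cmp_reassoc[OF R(2) m(1) W(2) m(2)]
      Cmp_reassoc[OF R(2) m(1) W(3) m(3)] R(6) F(4) W(8,9) by simp
  then have "(\<tau> \<cdot> m) \<cdot> r' = e1 \<cdot> r'"
    using Cmp_assoc[OF R(2) m(1) \<tau>(1)] \<tau>(2) R(7) by simp
  moreover have "f \<cdot> (\<tau> \<cdot> m) = f \<cdot> e1" using f\<tau>[OF m(1)] m(3) F(3) by simp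
  ultimately have 1: "fibrewise_homotopic f ((\<tau> \<cdot> m) \<cdot> H) (Idn C A)"
    using fibrewise_homotopicI[OF R(1,2) Cmp_in_Hom[OF m(1) \<tau>(1)] R(5) _ _ H(1) f(2)] H(3) by simp

  note sd0 = Cmp_in_Hom[OF P(4) s] and sd1 = Cmp_in_Hom[OF P(5) s]
  note idP = Idn_in_Hom[OF Hom_Obj(2)[OF P(2)]]
  have "f \<cdot> (s \<cdot> d0) = d0 \<cdot> Idn C P"
    using Cmp_reassoc[OF P(4) s f(2) fs] Idn_left[OF P(4)] Idn_right[OF P(4)] by simp
  \<comment> \<open>\<open>n\<close> attaches to a path in \<open>B\<close> the value of
    \<open>s\<close> at its starting point.\<close>
  then obtain n where n: "n \<in> Hom C P W" "p \<cdot> n = s \<cdot> d0" "q \<cdot> n = Idn C P"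
    using into_W[OF sd0 idP] by auto
  have "n \<cdot> r = j \<cdot> s"
  proof (rule W_eqI[OF Cmp_in_Hom[OF P(2) n(1)] Cmp_in_Hom[OF s W(7)]])
    show "p \<cdot> (n \<cdot> r) = p \<cdot> (j \<cdot> s)"
      using Cmp_reassoc[OF P(2) n(1) W(2) n(2)] Cmp_assoc[OF P(2,4) s] P(6) Idn_right[OF s]
        Cmp_reassoc[OF s W(7,2,8)] Idn_left[OF s] by simp
    show "q \<cdot> (n \<cdot> r) = q \<cdot> (j \<cdot> s)"
      using Cmp_reassoc[OF P(2) n(1) W(3) n(3)] Idn_left[OF P(2)] Cmp_reassoc[OF s W(7,3,9)]
        Cmp_assoc[OF s f(2) P(2)] fs Idn_right[OF P(2)] by simp
  qed
  then have "(\<tau> \<cdot> n) \<cdot> r = (s \<cdot> d1) \<cdot> r"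
    using Cmp_assoc[OF P(2) n(1) \<tau>(1)] Cmp_reassoc[OF s W(7) \<tau>(1,2)] Idn_left[OF s]
      Cmp_assoc[OF P(2,5) s] P(7) Idn_right[OF s] by simp
  moreover have "f \<cdot> (\<tau> \<cdot> n) = f \<cdot> (s \<cdot> d1)"
    using f\<tau>[OF n(1)] n(3) Idn_right[OF P(5)] Cmp_reassoc[OF P(5) s f(2) fs] Idn_left[OF P(5)] by simp
  ultimately have 2: "fibrewise_homotopic f ((\<tau> \<cdot> n) \<cdot> (F \<cdot> H)) ((s \<cdot> d1) \<cdot> (F \<cdot> H))"
    using fibrewise_homotopicI[OF P(1,2) Cmp_in_Hom[OF n(1) \<tau>(1)] sd1 _ _ FH f(2)] by simp

  have feH: "d0 \<cdot> (F \<cdot> H) = f" "d1 \<cdot> (F \<cdot> H) = f"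
    using Cmp_reassoc[OF H(1) F(1) P(4) F(2)] Cmp_assoc[OF H(1) R(4) f(2)] H(2)
      Cmp_reassoc[OF f(2) s f(2) fs] Idn_left[OF f(2)]
      Cmp_reassoc[OF H(1) F(1) P(5) F(3)] Cmp_assoc[OF H(1) R(5) f(2)] H(3) Idn_right[OF f(2)] by auto
  \<comment> \<open>The two fibrewise homotopies meet here: both sides have first component
    \<open>s \<cdot> f\<close> and second component \<open>F \<cdot> H\<close>, as
    \<open>f \<cdot> s\<close> is the identity.\<close>
  have "m \<cdot> H = n \<cdot> (F \<cdot> H)"
    using W_eqI[OF Cmp_in_Hom[OF H(1) m(1)] Cmp_in_Hom[OF FH n(1)]]
      Cmp_reassoc[OF H(1) m(1) W(2) m(2)] Cmp_reassoc[OF H(1) m(1) W(3) m(3)]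
      Cmp_reassoc[OF FH n(1) W(2) n(2)] Cmp_reassoc[OF FH n(1) W(3) n(3)]
      Cmp_assoc[OF FH P(4) s] feH H(2) Idn_left[OF FH] by simp
  then have eq: "(\<tau> \<cdot> n) \<cdot> (F \<cdot> H) = (\<tau> \<cdot> m) \<cdot> H"
    using Cmp_assoc[OF FH n(1) \<tau>(1)] Cmp_assoc[OF H(1) m(1) \<tau>(1)] by simp
  have "(s \<cdot> d1) \<cdot> (F \<cdot> H) = s \<cdot> f" using Cmp_assoc[OF FH P(5) s] feH(2) by simp
  then have 3: "fibrewise_homotopic f ((\<tau> \<cdot> m) \<cdot> H) (s \<cdot> f)" using 2 eq by simp
  note \<tau>mH = Cmp_in_Hom[OF H(1) Cmp_in_Hom[OF m(1) \<tau>(1)]]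
  have "fibrewise_homotopic f (s \<cdot> f) (Idn C A)"
    using fibrewise_homotopic_trans[OF f sf fibrewise_homotopic_sym[OF 3 f(2) \<tau>mH] 1] .
  then show thesis using that s fs by blast
qed

section \<open>Base change of acyclic fibrations\<close>

lemma acyclic_fibration_pullback_homotopy_equivalence:
  assumes f: "f \<in> Fib" "homotopy_equivalence C Fib f" and pb: "is_pullback C h f p q"
  shows "homotopy_equivalence C Fib p"
proof -
  define A B Z E where "A = Dom C f" and "B = Cod C f" and "Z = Dom C h" and "E = Dom C p"
  have fH: "f \<in> Hom C A B" and hH: "h \<in> Hom C Z B"
    using pb by (auto simp: is_pullback_def Hom_def A_def B_def Z_def)
  note pq = pullback_square[OF pb hH fH, folded E_def]
  note idA = Idn_in_Hom[OF Hom_Obj(1)[OF fH]] and idZ = Idn_in_Hom[OF Hom_Obj(1)[OF hH]]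
    and idE = Idn_in_Hom[OF Hom_Obj(1)[OF pq(1)]]
  obtain s where s: "s \<in> Hom C B A" "f \<cdot> s = Idn C B" "fibrewise_homotopic f (s \<cdot> f) (Idn C A)"
    using acyclic_fibration_section[OF f(1) fH f(2)] by metis
  note sf = Cmp_in_Hom[OF fH s(1)]
  obtain P r d0 d1 where P: "acof r" "r \<in> Hom C A P" "d0 \<in> Fib" "d0 \<in> Hom C P A" "d1 \<in> Hom C P A"
    "d0 \<cdot> r = Idn C A" "d1 \<cdot> r = Idn C A" "f \<cdot> d0 = f \<cdot> d1"
    and to_P: "\<And>X u v. fibrewise_homotopic f u v \<Longrightarrow> u \<in> Hom C X A \<Longrightarrow>
       \<exists>h \<in> Hom C X P. d0 \<cdot> h = u \<and> d1 \<cdot> h = v"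
    by (rule fibrewise_path_object[OF f(1) fH]) (rule that)
  obtain H where H: "H \<in> Hom C A P" "d0 \<cdot> H = s \<cdot> f" "d1 \<cdot> H = Idn C A" using to_P[OF s(3) sf] by blast
  note fd = Cmp_in_Hom[OF P(4) fH]
  have fd_Fib: "f \<cdot> d0 \<in> Fib" using Fib_Cmp[OF P(4) fH P(3) f(1)] .
  \<comment> \<open>\<open>P'\<close> is the base change of \<open>P\<close> along \<open>h\<close>:
    a point of \<open>Z\<close> with a path in the fibre of \<open>f\<close> over its image.\<close>
  obtain P' p' q' where P': "is_pullback C h (f \<cdot> d0) p' q'" "p' \<in> Hom C P' Z" "q' \<in> Hom C P' P"
    "h \<cdot> p' = (f \<cdot> d0) \<cdot> q'" "Dom C p' = P'"
    using obtain_pullback[OF fd_Fib fd hH] by metis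
  have into_E: "\<exists>w \<in> Hom C X E. p \<cdot> w = u \<and> q \<cdot> w = v"
    if "u \<in> Hom C X Z" "v \<in> Hom C X A" "h \<cdot> u = f \<cdot> v" for X u v
    using pullback_lift[OF pb hH fH that] E_def by metis
  have E_eqI: "w = w'" if "w \<in> Hom C X E" "w' \<in> Hom C X E" "p \<cdot> w = p \<cdot> w'" "q \<cdot> w = q \<cdot> w'" for X w w'
    using pullback_eqI[OF pb hH fH, folded E_def, OF that] .

  have fdr: "(f \<cdot> d0) \<cdot> r = f" using Cmp_assoc[OF P(2,4) fH] P(6) Idn_right[OF fH] by simp
  have "h \<cdot> p = (f \<cdot> d0) \<cdot> (r \<cdot> q)"
    using Cmp_reassoc[OF pq(2) P(2) fd fdr] pq(3) by simp
  then obtain u where u: "u \<in> Hom C E P'" "p' \<cdot> u = p" "q' \<cdot> u = r \<cdot> q"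
    using pullback_lift[OF P'(1) hH fd pq(1) Cmp_in_Hom[OF pq(2) P(2)]] P'(5) by metis
  \<comment> \<open>\<open>r\<close> is a map over \<open>B\<close> between the fibrations
    \<open>f\<close> and \<open>f \<cdot> d0\<close>, and \<open>u\<close> is its base change along
    \<open>h\<close>.\<close>
  have "acof u"
  proof (rule acyclic_cofibration_pullback[OF f(1) fd_Fib P(1) _ _ fdr pb P'(1) _ u(2,3)])
    show "r \<in> Hom C (Dom C f) (Dom C (f \<cdot> d0))" "Cod C f = Cod C (f \<cdot> d0)"
      using P(2) Hom_DomCod[OF fd] Hom_DomCod[OF fH] by auto
    show "u \<in> Hom C (Dom C p) (Dom C p')" using u(1) P'(5) E_def by simp
  qed
  \<comment> \<open>Since \<open>d\<close> lies over \<open>B\<close>, it has a base change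
    \<open>D\<close>; being a retraction of \<open>r\<close>, it becomes a retraction of
    \<open>u\<close>. So the two endpoint maps of \<open>P'\<close> agree on
    \<open>u\<close>.\<close>
  have end_E: "\<exists>D \<in> Hom C P' E. p \<cdot> D = p' \<and> q \<cdot> D = d \<cdot> q' \<and> D \<cdot> u = Idn C E"
    if d: "d \<in> Hom C P A" "d \<cdot> r = Idn C A" "f \<cdot> d0 = f \<cdot> d" for d
  proof -
    have "h \<cdot> p' = f \<cdot> (d \<cdot> q')" using P'(4) d(3) Cmp_assoc[OF P'(3) d(1) fH] by simp
    then obtain D where D: "D \<in> Hom C P' E" "p \<cdot> D = p'" "q \<cdot> D = d \<cdot> q'"
      using into_E[OF P'(2) Cmp_in_Hom[OF P'(3) d(1)]] by blast
    have "D \<cdot> u = Idn C E"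
      using E_eqI[OF Cmp_in_Hom[OF u(1) D(1)] idE] Cmp_reassoc[OF u(1) D(1) pq(1) D(2)] u(2,3)
        Cmp_reassoc[OF u(1) D(1) pq(2) D(3)] Cmp_assoc[OF u(1) P'(3) d(1)]
        Cmp_reassoc[OF pq(2) P(2) d(1,2)] Idn_left[OF pq(2)] Idn_right[OF pq(1)] Idn_right[OF pq(2)]
      by simp
    then show ?thesis using D by blast
  qed
  obtain D0 where D0: "D0 \<in> Hom C P' E" "p \<cdot> D0 = p'" "q \<cdot> D0 = d0 \<cdot> q'" "D0 \<cdot> u = Idn C E"
    using end_E[OF P(4,6) refl] by blast
  obtain D1 where D1: "D1 \<in> Hom C P' E" "p \<cdot> D1 = p'" "q \<cdot> D1 = d1 \<cdot> q'" "D1 \<cdot> u = Idn C E"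
    using end_E[OF P(5,7,8)] by blast

  \<comment> \<open>The homotopy \<open>H\<close> is a map over \<open>B\<close>, as it starts at
    \<open>s \<cdot> f\<close> and \<open>s\<close> is a strict section; hence it has a base change
    \<open>K\<close>.\<close>
  have "(f \<cdot> d0) \<cdot> H = f"
    using Cmp_assoc[OF H(1) P(4) fH] H(2) Cmp_reassoc[OF fH s(1) fH s(2)] Idn_left[OF fH] by simp
  then have "h \<cdot> p = (f \<cdot> d0) \<cdot> (H \<cdot> q)"
    using Cmp_reassoc[OF pq(2) H(1) fd] pq(3) by simp
  then obtain K where K: "K \<in> Hom C E P'" "p' \<cdot> K = p" "q' \<cdot> K = H \<cdot> q"
    using pullback_lift[OF P'(1) hH fd pq(1) Cmp_in_Hom[OF pq(2) H(1)]] P'(5) by metis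
  note sh = Cmp_in_Hom[OF hH s(1)]
  have "h \<cdot> Idn C Z = f \<cdot> (s \<cdot> h)"
    using Idn_right[OF hH] Cmp_reassoc[OF hH s(1) fH s(2)] Idn_left[OF hH] by simp
  then obtain s' where s': "s' \<in> Hom C Z E" "p \<cdot> s' = Idn C Z" "q \<cdot> s' = s \<cdot> h"
    using into_E[OF idZ sh] by blast
  have "D1 \<cdot> K = Idn C E"
    using E_eqI[OF Cmp_in_Hom[OF K(1) D1(1)] idE] Cmp_reassoc[OF K(1) D1(1) pq(1) D1(2)] K(2,3)
      Cmp_reassoc[OF K(1) D1(1) pq(2) D1(3)] Cmp_assoc[OF K(1) P'(3) P(5)]
      Cmp_reassoc[OF pq(2) H(1) P(5) H(3)] Idn_left[OF pq(2)] Idn_right[OF pq(1)] Idn_right[OF pq(2)]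
    by simp
  \<comment> \<open>On \<open>q\<close> both sides give \<open>s \<cdot> (f \<cdot> q)\<close>, by
    way of \<open>f \<cdot> q = h \<cdot> p\<close>; on \<open>p\<close> both give
    \<open>p\<close>.\<close>
  moreover have "D0 \<cdot> K = s' \<cdot> p"
    using E_eqI[OF Cmp_in_Hom[OF K(1) D0(1)] Cmp_in_Hom[OF pq(1) s'(1)]]
      Cmp_reassoc[OF K(1) D0(1) pq(1) D0(2)] K(2,3)
      Cmp_reassoc[OF K(1) D0(1) pq(2) D0(3)] Cmp_assoc[OF K(1) P'(3) P(4)]
      Cmp_reassoc[OF pq(2) H(1) P(4) H(2)] Cmp_assoc[OF pq(2) fH s(1)] pq(3)
      Cmp_reassoc[OF pq(1) s'(1) pq(1) s'(2)] Idn_left[OF pq(1)]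
      Cmp_reassoc[OF pq(1) s'(1) pq(2) s'(3)] Cmp_assoc[OF pq(1) hH s(1)]
    by simp
  moreover have "D0 \<cdot> K \<simeq> D1 \<cdot> K"
    using homotopicI[OF \<open>acof u\<close> u(1) D0(1) D1(1) _ K(1)] D0(4) D1(4) by simp
  ultimately have "s' \<cdot> p \<simeq> Idn C E" by simp
  moreover have "p \<cdot> s' \<simeq> Idn C Z" using s'(2) homotopic_refl[OF idZ] by simp
  ultimately show ?thesis using homotopy_equivalence_iff[OF pq(1)] s'(1) by blast
qed

section \<open>Verification of the axioms for categories of fibrant objects\<close>

theorem homotopy_equivalences_fibrant:
  "category_of_fibrant_objects C one Fib {f. homotopy_equivalence C Fib f}"
proof unfold_locales
  let ?W = "{f. homotopy_equivalence C Fib f}"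
  have Idn_W: "homotopy_equivalence C Fib (Idn C A)" if "A \<in> Obj C" for A
    using acyclic_cofibration_homotopy_equivalence[OF acyclic_cofibration_Idn[OF that] Idn_in_Hom[OF that]] .
  have "homotopy_equivalence C Fib (g \<cdot> f)"
    if "homotopy_equivalence C Fib f" "homotopy_equivalence C Fib g" "Cod C f = Dom C g" for f g
    using homotopy_equivalence_Cmp[of f "Dom C f" "Cod C f" g "Cod C g"] that
    by (simp add: homotopy_equivalence_def Hom_def)
  then show "wide_subcategory C ?W"
    using Idn_W unfolding wide_subcategory_def
    by (simp add: subset_iff homotopy_equivalence_def[THEN iffD1, THEN conjunct1])
  show "f \<in> ?W" if "is_iso C f" for f using iso_homotopy_equivalence[OF that] by simp
  fix f g X Y Z
  assume fg: "f \<in> Hom C X Y" "g \<in> Hom C Y Z"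
  show "g \<cdot> f \<in> ?W" if "f \<in> ?W" "g \<in> ?W"
    using homotopy_equivalence_Cmp[OF fg(1) _ fg(2)] that by simp
  show "f \<in> ?W" if "g \<in> ?W" "g \<cdot> f \<in> ?W"
    using homotopy_equivalence_cancel_left[OF fg] that by simp
  show "g \<in> ?W" if "f \<in> ?W" "g \<cdot> f \<in> ?W"
    using homotopy_equivalence_cancel_right[OF fg] that by simp
next
  let ?W = "{f. homotopy_equivalence C Fib f}"
  fix B Q p1 p2
  assume prod: "is_product C B B Q p1 p2"
  then have i: "Idn C B \<in> Hom C B B" using Idn_in_Hom by (simp add: is_product_def)
  \<comment> \<open>A path object provides the factorization, since its acyclic cofibration is a
    homotopy equivalence.\<close>
  obtain P i p where ip: "acof i" "p \<in> Fib" "i \<in> Hom C B P" "p \<in> Hom C P Q" "p \<cdot> i = diagonal C B p1 p2"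
    using obtain_factorization[OF pairing_product(1)[OF prod i i, folded diagonal_def]] by metis
  moreover have "Cod C i = Dom C p" using ip by (simp add: Hom_def)
  ultimately show "\<exists>w p. w \<in> ?W \<and> p \<in> Fib \<and> Cod C w = Dom C p \<and> p \<cdot> w = diagonal C B p1 p2"
    using acyclic_cofibration_homotopy_equivalence[OF ip(1,3)] by blast
next
  let ?W = "{f. homotopy_equivalence C Fib f}"
  show "p \<in> ?W" if "f \<in> Fib" "f \<in> ?W" "is_pullback C h f p q" for f h p q
    using acyclic_fibration_pullback_homotopy_equivalence that by blast
qed

end

theorem theorem3p13:
  fixes C :: "('o, 'a) cat" and one :: 'o and Fib :: "'a set"
  assumes "type_theoretic_fibration_category C one Fib"
  shows "category_of_fibrant_objects C one Fib {f. homotopy_equivalence C Fib f}"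
  using type_theoretic_fibration_category.homotopy_equivalences_fibrant[OF assms] .

end
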